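(* Let $\mathcal{F}=\{f_n: n=1,2,\dots\}$ be a family of boolean functions, $f_n:\{0,1\}^n\to\{0,1\}$. Then $\mathcal{F}$ is matchgate-computable with poly-bounded error if and only if $\mathcal{F}$ is a family of linear threshold gates with polynomial integer weight.
   Context: Matchgates. A matchgate is a two-qubit unitary $G$ whose matrix in the standard basis $|00\rangle,|01\rangle,|10\rangle,|11\rangle$ is $$G=\begin{pmatrix} a & 0 & 0 & b \\ 0 & u & v & 0 \\ 0 & x & y & 0 \\ c & 0 & 0 & d \end{pmatrix},\quad \begin{pmatrix} a & b \\ c & d \end{pmatrix}\in SU(2),\quad \begin{pmatrix} u & v \\ x & y \end{pmatrix}\in SU(2).$$ A matchgate circuit on $m$ qubits (arranged on a line $1,\dots,m$) is a unitary that is a finite product of matchgates, each acting on a pair of nearest-neighbor qubits $(k,k+1)$. Global phases are irrelevant. No bound is placed on the number of gates. Computability. Let $f:\{0,1\}^n\to\{0,1\}$ and let $U$ be an $m$-qubit unitary with $m\geq n$. $U$ computes $f$ with probability at least $p$ if for every $x\in\{0,1\}^n$, preparing $U|x,0\rangle$ (where $0$ denotes a string of $m-n$ zeros) and measuring the first qubit in the computational basis yields outcome $f(x)$ with probability at least $p$. Poly-bounded error. The family $\mathcal{F}$ is matchgate-computable with poly-bounded error if there exist probabilities $p_n\in(0.5,1]$ ($n\ge1$) and a polynomial $q$, positive on the positive integers, with $p_n\geq \frac12+\frac1{q(n)}$ for all sufficiently large $n$, and matchgate circuits $U_n$ (on any number $m_n\geq n$ of qubits) such that, for every $n$, $U_n$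 computes $f_n$ with probability at least $p_n$. Linear threshold gates. For $x\in\{0,1\}^n$ let $\hat x\in\{\pm1\}^n$ with $\hat x_k=(-1)^{x_k}$. A function $f:\{0,1\}^n\to\{0,1\}$ is a linear threshold gate (LTG) if there exist $w\in\mathbb{R}^n$ and $\theta\in\mathbb{R}$ such that $(-1)^{f(x)}=\mathrm{sign}(w^T\hat x+\theta)$ for all $x\in\{0,1\}^n$ (in particular $w^T\hat x+\theta\neq0$ for all $x$); $(w,\theta)$ is then called a representation of $f$, and an integer representation if all $w_k$ and $\theta$ are integers. Every LTG has an integer representation. The integer weight $\omega(f)$ of an LTG $f$ is the minimum of $\|w\|_1+|\theta|=\sum_k|w_k|+|\theta|$ over all integer representations of $f$. A family $\{f_n\}$ of LTGs, $f_n$ acting on $n$ bits, has polynomial integer weight if $\omega(f_n)$ is bounded above by a polynomial in $n$. *)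

theory Defs
  imports Jordan_Normal_Form.Schur_Decomposition
begin

text \<open>
  An \<open>m\<close>-qubit state is a vector of dimension \<open>2 ^ m\<close>. Bit strings \<open>x\<^sub>1 \<dots> x\<^sub>m\<close> are Boolean lists;
  \<open>basis_index\<close> is the big-endian binary value, so qubit 1 (the head of the list) is the most
  significant bit and the order of tensor factors agrees with the Kronecker product.
\<close>

definition basis_index :: "bool list \<Rightarrow> nat" where
  "basis_index x = horner_sum of_bool 2 (rev x)"

definition basis_state :: "bool list \<Rightarrow> complex vec" where
  "basis_state x = unit_vec (2 ^ length x) (basis_index x)"

definition kron :: "complex mat \<Rightarrow> complex mat \<Rightarrow> complex mat" where
  "kron A B = mat (dim_row A * dim_row B) (dim_col A * dim_col B)
     (\<lambda>(i, j). A $$ (i div dim_row B, j div dim_col B) * B $$ (i mod dim_row B, j mod dim_col B))"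

definition SU :: "nat \<Rightarrow> complex mat set" where
  "SU n = {A \<in> carrier_mat n n. mat_adjoint A * A = 1\<^sub>m n \<and> det A = 1}"

definition matchgate :: "complex mat \<Rightarrow> complex mat \<Rightarrow> complex mat" where
  "matchgate A B = mat_of_rows_list 4
     [[A $$ (0,0), 0,          0,          A $$ (0,1)],
      [0,          B $$ (0,0), B $$ (0,1), 0         ],
      [0,          B $$ (1,0), B $$ (1,1), 0         ],
      [A $$ (1,0), 0,          0,          A $$ (1,1)]]"

definition matchgates :: "complex mat set" where
  "matchgates = {matchgate A B | A B. A \<in> SU 2 \<and> B \<in> SU 2}"

text \<open>The two-qubit gate \<open>G\<close> acting on qubits \<open>k\<close> and \<open>k + 1\<close> of \<open>m\<close>; meaningful for \<open>1 \<le> k < m\<close>.\<close>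

definition apply_at :: "nat \<Rightarrow> nat \<Rightarrow> complex mat \<Rightarrow> complex mat" where
  "apply_at m k G = kron (kron (1\<^sub>m (2 ^ (k - 1))) G) (1\<^sub>m (2 ^ (m - k - 1)))"

inductive_set matchgate_circuits :: "nat \<Rightarrow> complex mat set" for m :: nat where
  empty: "1\<^sub>m (2 ^ m) \<in> matchgate_circuits m"
| gate: "U \<in> matchgate_circuits m \<Longrightarrow> G \<in> matchgates \<Longrightarrow> 1 \<le> k \<Longrightarrow> k < m
    \<Longrightarrow> apply_at m k G * U \<in> matchgate_circuits m"

text \<open>Probability that measuring the first qubit of the \<open>m\<close>-qubit state \<open>\<psi>\<close> gives outcome \<open>b\<close>.\<close>

definition first_qubit_prob :: "nat \<Rightarrow> complex vec \<Rightarrow> bool \<Rightarrow> real" where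
  "first_qubit_prob m \<psi> b = (\<Sum>y | length y = m \<and> hd y = b. (cmod (\<psi> $ basis_index y))\<^sup>2)"

text \<open>A Boolean function on \<open>n\<close> bits is a predicate on lists of which only the values on
  lists of length \<open>n\<close> matter.\<close>

definition computes_with_prob ::
  "nat \<Rightarrow> complex mat \<Rightarrow> nat \<Rightarrow> (bool list \<Rightarrow> bool) \<Rightarrow> real \<Rightarrow> bool" where
  "computes_with_prob m U n f p \<longleftrightarrow>
     (\<forall>x. length x = n \<longrightarrow>
        first_qubit_prob m (U *\<^sub>v basis_state (x @ replicate (m - n) False)) (f x) \<ge> p)"

definition matchgate_computable_poly_bounded_error :: "(nat \<Rightarrow> bool list \<Rightarrow> bool) \<Rightarrow> bool" where
  "matchgate_computable_poly_bounded_error F \<longleftrightarrow>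
     (\<exists>(p :: nat \<Rightarrow> real) (q :: real poly) (m :: nat \<Rightarrow> nat) (U :: nat \<Rightarrow> complex mat).
        (\<forall>n\<ge>1. 1/2 < p n \<and> p n \<le> 1) \<and>
        (\<forall>n::nat. n \<ge> 1 \<longrightarrow> poly q (real n) > 0) \<and>
        (\<forall>\<^sub>F n in sequentially. p n \<ge> 1/2 + 1 / poly q (real n)) \<and>
        (\<forall>n\<ge>1. n \<le> m n \<and> U n \<in> matchgate_circuits (m n) \<and>
                computes_with_prob (m n) (U n) n (F n) (p n)))"

definition pm :: "bool \<Rightarrow> real" where
  "pm b = (-1) ^ (of_bool b :: nat)"

text \<open>Since \<open>sgn 0 = 0\<close>, the equation below forces the argument of \<open>sgn\<close> to be nonzero.
  Weights \<open>w k\<close> with \<open>k \<ge> n\<close> are irrelevant; indices run over \<open>0, \<dots>, n - 1\<close>.\<close>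

definition ltg_representation ::
  "nat \<Rightarrow> (bool list \<Rightarrow> bool) \<Rightarrow> (nat \<Rightarrow> real) \<Rightarrow> real \<Rightarrow> bool" where
  "ltg_representation n f w \<theta> \<longleftrightarrow>
     (\<forall>x. length x = n \<longrightarrow> pm (f x) = sgn ((\<Sum>k<n. w k * pm (x ! k)) + \<theta>))"

definition linear_threshold_gate :: "nat \<Rightarrow> (bool list \<Rightarrow> bool) \<Rightarrow> bool" where
  "linear_threshold_gate n f \<longleftrightarrow> (\<exists>w \<theta>. ltg_representation n f w \<theta>)"

definition integer_representation ::
  "nat \<Rightarrow> (bool list \<Rightarrow> bool) \<Rightarrow> (nat \<Rightarrow> real) \<Rightarrow> real \<Rightarrow> bool" where
  "integer_representation n f w \<theta> \<longleftrightarrow>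
     ltg_representation n f w \<theta> \<and> (\<forall>k<n. w k \<in> \<int>) \<and> \<theta> \<in> \<int>"

text \<open>The weight of an integer representation is a natural number, so the minimum is attained
  as soon as an integer representation exists; without one the value is unspecified.\<close>

definition integer_weight :: "nat \<Rightarrow> (bool list \<Rightarrow> bool) \<Rightarrow> nat" where
  "integer_weight n f =
     (LEAST W. \<exists>w \<theta>. integer_representation n f w \<theta> \<and> real W = (\<Sum>k<n. \<bar>w k\<bar>) + \<bar>\<theta>\<bar>)"

lemma integer_weight_is_minimum:
  assumes "integer_representation n f w \<theta>"
  shows "real (integer_weight n f) \<le> (\<Sum>k<n. \<bar>w k\<bar>) + \<bar>\<theta>\<bar>"
    and "\<exists>w' \<theta>'. integer_representation n f w' \<theta>' \<and>
           real (integer_weight n f) = (\<Sum>k<n. \<bar>w' k\<bar>) + \<bar>\<theta>'\<bar>"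
proof -
  let ?P = "\<lambda>W::nat. \<exists>w \<theta>. integer_representation n f w \<theta> \<and> real W = (\<Sum>k<n. \<bar>w k\<bar>) + \<bar>\<theta>\<bar>"
  have "(\<Sum>k<n. \<bar>w k\<bar>) + \<bar>\<theta>\<bar> \<in> \<int>"
    using assms by (auto simp: integer_representation_def intro!: Ints_add Ints_sum Ints_abs)
  moreover have "(\<Sum>k<n. \<bar>w k\<bar>) + \<bar>\<theta>\<bar> \<ge> 0"
    by (simp add: sum_nonneg)
  ultimately obtain W :: nat where W: "real W = (\<Sum>k<n. \<bar>w k\<bar>) + \<bar>\<theta>\<bar>"
    by (metis Ints_cases of_int_0_le_iff of_int_of_nat_eq zero_le_imp_eq_int)
  then have P: "?P W"
    using assms by blast
  show "real (integer_weight n f) \<le> (\<Sum>k<n. \<bar>w k\<bar>) + \<bar>\<theta>\<bar>"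
    using Least_le[of ?P, OF P] unfolding integer_weight_def by (simp flip: W)
  show "\<exists>w' \<theta>'. integer_representation n f w' \<theta>' \<and>
           real (integer_weight n f) = (\<Sum>k<n. \<bar>w' k\<bar>) + \<bar>\<theta>'\<bar>"
    using LeastI[of ?P, OF P] unfolding integer_weight_def .
qed

definition polynomial_integer_weight :: "(nat \<Rightarrow> bool list \<Rightarrow> bool) \<Rightarrow> bool" where
  "polynomial_integer_weight F \<longleftrightarrow>
     (\<exists>q :: real poly. \<forall>n\<ge>1. real (integer_weight n (F n)) \<le> poly q (real n))"

end

(* The Heisenberg picture of a matchgate acts linearly on the Majorana operators of the
   Jordan-Wigner representation, and Pauli Z on the first qubit is a product of two of them. Hence
   its expectation after a circuit is an affine function of the input signs, and this function is
   bounded by 1 on the cube, so its coefficients have absolute sum at most 1. An error bound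
   p > 1/2 is a margin 2p - 1 for this function; scaling by (n + 1) / (2p - 1) and rounding gives
   small integer weights. Conversely, coefficients with absolute sum 1 are realised by induction on
   the number of qubits, the gate on the first two qubits being applied last; dividing an integer
   representation by its weight W leaves the margin 1 / W. *)

theory Submission
  imports Defs
begin

section \<open>Bit strings and matrix entries\<close>

text \<open>A product of two linear combinations of Majorana operators has quadratically many terms,
  but in a basis state only the terms with both factors on one qubit have a nonzero expectation.
  Each qubit then contributes a function of its own bit, which makes the result affine. Ancillas
  start in 0, so their coefficients are absorbed into the threshold: neither their number nor the
  number of gates enters the weight bound. The n + 1 in the scaling counts the roundings, n weights
  and one threshold; each is off by at most 1/2, so the total error is at most half the scaled
  margin. In the converse the threshold becomes the coefficient of an ancilla. Matrices of dimension
  2 ^ m are awkward for inductions on qubits; hence circuits are translated into maps on functions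
  of bit strings, where a gate is a structural recursion.\<close>

lemma basis_index_append:
  "basis_index (x @ y) = basis_index x * 2 ^ length y + basis_index y"
  by (simp add: basis_index_def horner_sum_append)

lemma basis_index_less: "basis_index x < 2 ^ length x"
  using horner_sum_of_bool_2_less[of "rev x", where 'a = nat] by (simp add: basis_index_def)

lemma basis_index_inj:
  assumes "length x = length y" "basis_index x = basis_index y"
  shows "x = y"
  using assms
proof (induction x y rule: rev_induct2)
  case (4 x xs y ys)
  have digits: "i * 2 + of_bool x = j * 2 + of_bool y \<Longrightarrow> i = j \<and> x = y" for i j :: nat
    by (cases x; cases y; simp) presburger+
  have snoc: "basis_index (l @ [b]) = basis_index l * 2 + of_bool b" for l b
    by (simp add: basis_index_def)
  have "basis_index xs * 2 + of_bool x = basis_index ys * 2 + of_bool y"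
    using 4(3) unfolding snoc .
  then have "basis_index xs = basis_index ys \<and> x = y"
    by (rule digits)
  then show ?case using 4 by simp
qed auto

lemma finite_bit_strings [simp]: "finite {x :: bool list. length x = m}"
  using finite_lists_length_eq[of "UNIV :: bool set" m] by simp

lemma bij_betw_basis_index: "bij_betw basis_index {x. length x = m} {0..<2 ^ m}"
proof -
  have inj: "inj_on basis_index {x. length x = m}"
    by (auto simp: inj_on_def intro: basis_index_inj)
  have "card {x :: bool list. length x = m} = 2 ^ m"
    using card_lists_length_eq[of "UNIV :: bool set" m] by simp
  then have "card (basis_index ` {x. length x = m}) = card {0..<2 ^ m :: nat}"
    by (simp add: card_image[OF inj])
  moreover have "basis_index ` {x. length x = m} \<subseteq> {0..<2 ^ m}"
    using basis_index_less by auto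
  ultimately show ?thesis
    using inj by (simp add: bij_betw_def card_subset_eq)
qed

lemma sum_bit_strings_Suc:
  fixes h :: "bool list \<Rightarrow> 'a::comm_monoid_add"
  shows "(\<Sum>x | length x = Suc m. h x)
    = (\<Sum>x | length x = m. h (False # x)) + (\<Sum>x | length x = m. h (True # x))"
proof -
  have "{x. length x = Suc m} = (#) False ` {x. length x = m} \<union> (#) True ` {x. length x = m}"
    by (auto simp: length_Suc_conv)
  then have "(\<Sum>x | length x = Suc m. h x)
      = (\<Sum>x \<in> (#) False ` {x. length x = m}. h x) + (\<Sum>x \<in> (#) True ` {x. length x = m}. h x)"
    by (simp only:) (rule sum.union_disjoint, auto)
  then show ?thesis
    by (simp add: sum.reindex)
qed

section \<open>Entries of Kronecker products and of gates on two adjacent qubits\<close>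

lemma kron_index:
  assumes "i < dim_row A * dim_row B" "j < dim_col A * dim_col B"
  shows "kron A B $$ (i, j) =
    A $$ (i div dim_row B, j div dim_col B) * B $$ (i mod dim_row B, j mod dim_col B)"
  using assms by (simp add: kron_def)

lemma kron_dims [simp]:
  "dim_row (kron A B) = dim_row A * dim_row B" "dim_col (kron A B) = dim_col A * dim_col B"
  by (simp_all add: kron_def)

lemma apply_at_dims:
  assumes "G \<in> carrier_mat 4 4" "1 \<le> k" "k < m"
  shows "apply_at m k G \<in> carrier_mat (2 ^ m) (2 ^ m)"
proof -
  have "(2::nat) ^ (k - 1) * 4 * 2 ^ (m - k - 1) = 2 ^ ((k - 1) + 2 + (m - k - 1))"
    by (simp add: power_add)
  also have "(k - 1) + 2 + (m - k - 1) = m" using assms by simp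
  finally show ?thesis using assms by (intro carrier_matI) (simp_all add: apply_at_def)
qed

text \<open>The order is big-endian, so division and remainder by \<open>2 ^ length y\<close> split
  the index of \<open>x @ y\<close> into those of \<open>x\<close> and \<open>y\<close>, as in the
  entries of \<open>kron\<close>.\<close>

lemma kron_index_append:
  assumes "A \<in> carrier_mat (2 ^ length x) (2 ^ length x)" "B \<in> carrier_mat (2 ^ length y) (2 ^ length y)"
    and "length x' = length x" "length y' = length y"
  shows "kron A B $$ (basis_index (x @ y), basis_index (x' @ y'))
    = A $$ (basis_index x, basis_index x') * B $$ (basis_index y, basis_index y')"
proof -
  have "basis_index (x @ y) < 2 ^ length x * 2 ^ length y"
    "basis_index (x' @ y') < 2 ^ length x * 2 ^ length y"
    using basis_index_less[of "x @ y"] basis_index_less[of "x' @ y'"] assms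
    by (simp_all add: power_add)
  moreover have "basis_index (x @ y) div 2 ^ length y = basis_index x"
    "basis_index (x' @ y') div 2 ^ length y = basis_index x'"
    "basis_index (x @ y) mod 2 ^ length y = basis_index y"
    "basis_index (x' @ y') mod 2 ^ length y = basis_index y'"
    using basis_index_less[of y] basis_index_less[of y'] assms by (simp_all add: basis_index_append)
  ultimately show ?thesis using assms by (subst kron_index) auto
qed

lemma one_mat_basis_index:
  "length x = length y \<Longrightarrow>
    (1\<^sub>m (2 ^ length x) :: complex mat) $$ (basis_index x, basis_index y) = of_bool (x = y)"
  using basis_index_less[of x] basis_index_less[of y] basis_index_inj[of x y] by auto

lemma apply_at_index:
  assumes G: "G \<in> carrier_mat 4 4"
    and "length x' = length x" "length y' = length y"
  shows "apply_at (length x + 2 + length y) (Suc (length x)) G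
      $$ (basis_index (x @ [s, t] @ y), basis_index (x' @ [s', t'] @ y'))
    = of_bool (x = x') * G $$ (basis_index [s, t], basis_index [s', t']) * of_bool (y = y')"
proof -
  let ?I = "1\<^sub>m (2 ^ length x) :: complex mat"
  have "kron ?I G \<in> carrier_mat (2 ^ length (x @ [s, t])) (2 ^ length (x @ [s, t]))"
    using G by (intro carrier_matI) (simp_all add: power_add)
  then have "kron (kron ?I G) (1\<^sub>m (2 ^ length y))
      $$ (basis_index ((x @ [s, t]) @ y), basis_index ((x' @ [s', t']) @ y'))
    = kron ?I G $$ (basis_index (x @ [s, t]), basis_index (x' @ [s', t']))
      * 1\<^sub>m (2 ^ length y) $$ (basis_index y, basis_index y')"
    using assms by (intro kron_index_append) auto
  also have "kron ?I G $$ (basis_index (x @ [s, t]), basis_index (x' @ [s', t']))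
    = ?I $$ (basis_index x, basis_index x') * G $$ (basis_index [s, t], basis_index [s', t'])"
    using assms by (intro kron_index_append) auto
  finally show ?thesis
    using assms by (simp add: apply_at_def one_mat_basis_index)
qed

text \<open>In each row at most four entries are nonzero: those in the columns of strings that agree
  with the row outside the two qubits.\<close>

lemma apply_at_mult_vec:
  assumes G: "G \<in> carrier_mat 4 4" and v: "v \<in> carrier_vec (2 ^ (length x + 2 + length y))"
  shows "(apply_at (length x + 2 + length y) (Suc (length x)) G *\<^sub>v v) $ basis_index (x @ [s, t] @ y)
    = (\<Sum>(s', t') \<in> UNIV. G $$ (basis_index [s, t], basis_index [s', t'])
        * v $ basis_index (x @ [s', t'] @ y))"
proof -
  let ?m = "length x + 2 + length y"
  let ?M = "apply_at ?m (Suc (length x)) G"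
  let ?i = "basis_index (x @ [s, t] @ y)"
  let ?S = "(\<lambda>(s', t'). x @ [s', t'] @ y) ` UNIV"
  have M: "?M \<in> carrier_mat (2 ^ ?m) (2 ^ ?m)"
    using G by (intro apply_at_dims) auto
  have i: "?i < 2 ^ ?m"
    using basis_index_less[of "x @ [s, t] @ y"] by (simp add: add.assoc)
  have "(?M *\<^sub>v v) $ ?i = (\<Sum>j = 0..<2 ^ ?m. ?M $$ (?i, j) * v $ j)"
    using M v i by (auto simp: scalar_prod_def intro!: sum.cong)
  also have "\<dots> = (\<Sum>z | length z = ?m. ?M $$ (?i, basis_index z) * v $ basis_index z)"
    by (rule sum.reindex_bij_betw[OF bij_betw_basis_index, symmetric])
  also have "\<dots> = (\<Sum>z \<in> ?S. ?M $$ (?i, basis_index z) * v $ basis_index z)"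
  proof (rule sum.mono_neutral_right)
    show "\<forall>z \<in> {z. length z = ?m} - ?S. ?M $$ (?i, basis_index z) * v $ basis_index z = 0"
    proof
      fix z assume z: "z \<in> {z. length z = ?m} - ?S"
      define x' where "x' = take (length x) z"
      define y' where "y' = drop (length x + 2) z"
      obtain s' t' where st: "take 2 (drop (length x) z) = [s', t']"
      proof -
        have "length (take 2 (drop (length x) z)) = Suc (Suc 0)" using z by simp
        then show thesis using that by (metis length_0_conv length_Suc_conv)
      qed
      have "z = take (length x) z @ take 2 (drop (length x) z) @ drop 2 (drop (length x) z)"
        by (simp only: append_take_drop_id)
      then have zz: "z = x' @ [s', t'] @ y'"
        unfolding st x'_def y'_def by (simp add: add.commute)
      have "x = x' \<longrightarrow> y \<noteq> y'" using z zz by auto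
      moreover have "length x' = length x" "length y' = length y"
        using z by (auto simp: x'_def y'_def)
      ultimately show "?M $$ (?i, basis_index z) * v $ basis_index z = 0"
        unfolding zz using apply_at_index[OF G] by auto
    qed
  qed auto
  also have "\<dots> = (\<Sum>(s', t') \<in> UNIV. ?M $$ (?i, basis_index (x @ [s', t'] @ y))
        * v $ basis_index (x @ [s', t'] @ y))"
    by (subst sum.reindex) (auto simp: inj_on_def case_prod_unfold)
  also have "\<dots> = (\<Sum>(s', t') \<in> UNIV. G $$ (basis_index [s, t], basis_index [s', t'])
        * v $ basis_index (x @ [s', t'] @ y))"
    by (intro sum.cong refl) (auto simp: apply_at_index[OF G, where x' = x and y' = y, simplified])
  finally show ?thesis .
qed

section \<open>Circuits as maps on amplitude functions\<close>

text \<open>With determinant 1 the inverse is the adjugate; equating it with the adjoint expresses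
  the second row through the first, so a matchgate is given by the first rows of its two
  blocks.\<close>

lemma SU_2_iff:
  "A \<in> SU 2 \<longleftrightarrow> A \<in> carrier_mat 2 2 \<and>
     A $$ (1,0) = - cnj (A $$ (0,1)) \<and> A $$ (1,1) = cnj (A $$ (0,0)) \<and>
     A $$ (0,0) * cnj (A $$ (0,0)) + A $$ (0,1) * cnj (A $$ (0,1)) = 1"
proof (cases "A \<in> carrier_mat 2 2")
  case True
  define a b c d where abcd: "a = A $$ (0,0)" "b = A $$ (0,1)" "c = A $$ (1,0)" "d = A $$ (1,1)"
  have adj_carrier: "mat_adjoint A \<in> carrier_mat 2 2"
    using True by (intro carrier_matI) (simp_all add: mat_adjoint_def)
  have adj: "mat_adjoint A $$ (i, j) = cnj (A $$ (j, i))" if "i < 2" "j < 2" for i j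
    using True that by (simp add: mat_adjoint_def mat_of_rows_index)
  have sum2: "(\<Sum>i = 0..<2. h i) = h 0 + h 1" for h :: "nat \<Rightarrow> complex"
    by (simp add: numeral_2_eq_2)
  have prod: "(mat_adjoint A * A) $$ (i, j) = cnj (A $$ (0, i)) * A $$ (0, j) + cnj (A $$ (1, i)) * A $$ (1, j)"
    if "i < 2" "j < 2" for i j
    using True adj_carrier that adj by (simp add: scalar_prod_def sum2)
  have dims: "dim_row (mat_adjoint A * A) = 2" "dim_col (mat_adjoint A * A) = 2"
    using True adj_carrier by simp_all
  have "mat_adjoint A * A = 1\<^sub>m 2 \<longleftrightarrow>
      (\<forall>i<2. \<forall>j<2. (mat_adjoint A * A) $$ (i, j) = (if i = j then 1 else 0))"
    using dims by (auto simp: mat_eq_iff)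
  also have "\<dots> \<longleftrightarrow>
      cnj a * a + cnj c * c = 1 \<and> cnj a * b + cnj c * d = 0 \<and>
      cnj b * a + cnj d * c = 0 \<and> cnj b * b + cnj d * d = 1"
    unfolding abcd by (simp add: prod less_2_cases_iff all_conj_distrib imp_conjR disj_imp conj_ac
        del: index_mult_mat) (auto simp: prod simp del: index_mult_mat)
  finally have unit: "mat_adjoint A * A = 1\<^sub>m 2 \<longleftrightarrow>
      cnj a * a + cnj c * c = 1 \<and> cnj a * b + cnj c * d = 0 \<and>
      cnj b * a + cnj d * c = 0 \<and> cnj b * b + cnj d * d = 1" .
  have det: "det A = a * d - b * c"
  proof -
    have minor: "mat_delete A 0 j \<in> carrier_mat 1 1" for j
      using mat_delete_carrier[of A 2 2 0 j] True by simp
    have "det A = (\<Sum>j<2. A $$ (0, j) * ((- 1) ^ j * mat_delete A 0 j $$ (0, 0)))"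
      using laplace_expansion_row[OF True, of 0] det_single[OF minor] by (simp add: cofactor_def)
    then show ?thesis
      using True by (simp add: numeral_2_eq_2 mat_delete_def abcd)
  qed
  have "A \<in> SU 2 \<longleftrightarrow> cnj a * a + cnj c * c = 1 \<and> cnj a * b + cnj c * d = 0 \<and>
      cnj b * a + cnj d * c = 0 \<and> cnj b * b + cnj d * d = 1 \<and> a * d - b * c = 1"
    using True by (simp add: SU_def unit det)
  also have "\<dots> \<longleftrightarrow> c = - cnj b \<and> d = cnj a \<and> a * cnj a + b * cnj b = 1"
  proof safe
    assume h: "cnj a * a + cnj c * c = 1" "cnj a * b + cnj c * d = 0"
      "cnj b * a + cnj d * c = 0" "cnj b * b + cnj d * d = 1" "a * d - b * c = 1"
    \<comment> \<open>Multiply the norm equation of the first column by \<open>d\<close> and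
      eliminate with orthogonality and the determinant; the next step treats \<open>c\<close>
      likewise with the second column.\<close>
    show d: "d = cnj a" using h(1,2,5) by Groebner_Basis.algebra
    show c: "c = - cnj b" using h(3,4,5) by Groebner_Basis.algebra
    show "a * cnj a + b * cnj b = 1" using h(5) unfolding c d by simp
  qed (simp_all add: algebra_simps)
  finally show ?thesis using True by (simp add: abcd)
qed (simp add: SU_def)

text \<open>The rows of an \<open>SU 2\<close> matrix are \<open>(a, b)\<close> and \<open>(-cnj b, cnj a)\<close>; here \<open>(a, b)\<close> is
  the first row of the block acting on even parity and \<open>(u, v)\<close> of the one acting on odd parity.
  Qubits are counted from \<open>0\<close>.\<close>

fun gate :: "nat \<Rightarrow> complex \<Rightarrow> complex \<Rightarrow> complex \<Rightarrow> complex
    \<Rightarrow> (bool list \<Rightarrow> complex) \<Rightarrow> bool list \<Rightarrow> complex" where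
  "gate 0 a b u v \<psi> (s # t # y) =
     (let p = (if s = t then a else u); q = (if s = t then b else v)
      in if s then - cnj q * \<psi> (False # (s \<noteq> t) # y) + cnj p * \<psi> (True # (s = t) # y)
         else p * \<psi> (False # (s \<noteq> t) # y) + q * \<psi> (True # (s = t) # y))"
| "gate (Suc k) a b u v \<psi> (s # y) = gate k a b u v (\<lambda>z. \<psi> (s # z)) y"
| "gate _ a b u v \<psi> y = \<psi> y"

text \<open>Written without moduli, the condition is a polynomial identity in the numbers and their
  conjugates, which Groebner basis reasoning can use directly.\<close>

definition unit_pair :: "complex \<Rightarrow> complex \<Rightarrow> bool" where
  "unit_pair a b \<longleftrightarrow> a * cnj a + b * cnj b = 1"

inductive circuit_map :: "nat \<Rightarrow> ((bool list \<Rightarrow> complex) \<Rightarrow> bool list \<Rightarrow> complex) \<Rightarrow> bool"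
  for m where
  id: "circuit_map m (\<lambda>\<psi>. \<psi>)"
| gate: "circuit_map m T \<Longrightarrow> Suc k < m \<Longrightarrow> unit_pair a b \<Longrightarrow> unit_pair u v
    \<Longrightarrow> circuit_map m (\<lambda>\<psi>. gate k a b u v (T \<psi>))"

text \<open>Circuit maps act on functions of lists of all lengths, but a gate preserves length; so
  equations known only on strings of length \<open>m\<close> can be used under a gate.\<close>

lemma gate_cong:
  assumes "\<And>z. length z = length y \<Longrightarrow> \<psi> z = \<phi> z"
  shows "gate k a b u v \<psi> y = gate k a b u v \<phi> y"
  using assms by (induction k a b u v \<psi> y arbitrary: \<phi> rule: gate.induct) (auto simp: Let_def)

lemma gate_append:
  "gate (length x) a b u v \<psi> (x @ y) = gate 0 a b u v (\<lambda>z. \<psi> (x @ z)) y"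
  by (induction x arbitrary: \<psi>) auto

lemma matchgate_carrier: "matchgate A B \<in> carrier_mat 4 4"
  by (simp add: matchgate_def mat_of_rows_list_def numeral_eq_Suc)

text \<open>The parity \<open>s = t\<close> selects the block; within either block the first bit
  \<open>s\<close> is the row number, since 00, 11 and 01, 10 are listed in this order.\<close>

lemma matchgate_index:
  "matchgate A B $$ (basis_index [s, t], basis_index [s', t']) =
     (if (s = t) = (s' = t') then (if s = t then A else B) $$ (of_bool s, of_bool s') else 0)"
  by (cases s; cases t; cases s'; cases t')
     (simp_all add: matchgate_def mat_of_rows_list_def basis_index_def)

lemma apply_matchgate:
  assumes A: "A \<in> SU 2" and B: "B \<in> SU 2" and k: "Suc k < m"
    and w: "w \<in> carrier_vec (2 ^ m)" and z: "length z = m"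
  shows "(apply_at m (Suc k) (matchgate A B) *\<^sub>v w) $ basis_index z
    = gate k (A $$ (0,0)) (A $$ (0,1)) (B $$ (0,0)) (B $$ (0,1)) (\<lambda>y. w $ basis_index y) z"
proof -
  define x where "x = take k z"
  define y where "y = drop (k + 2) z"
  obtain s t where st: "take 2 (drop k z) = [s, t]"
  proof -
    have "length (take 2 (drop k z)) = Suc (Suc 0)" using z k by simp
    then show thesis using that by (metis length_0_conv length_Suc_conv)
  qed
  have "z = take k z @ take 2 (drop k z) @ drop 2 (drop k z)"
    by (simp only: append_take_drop_id)
  then have zz: "z = x @ [s, t] @ y"
    unfolding st x_def y_def by (simp add: add.commute)
  have len: "length x = k" using z k by (simp add: x_def)
  then have m: "m = length x + 2 + length y" using z zz by simp
  have UNIV: "(UNIV :: (bool \<times> bool) set) = {(False,False),(False,True),(True,False),(True,True)}"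
    by auto
  have "(apply_at m (Suc k) (matchgate A B) *\<^sub>v w) $ basis_index z
    = (\<Sum>(s', t') \<in> UNIV. matchgate A B $$ (basis_index [s, t], basis_index [s', t'])
        * w $ basis_index (x @ [s', t'] @ y))"
    using apply_at_mult_vec[OF matchgate_carrier, of w x y] w
    unfolding zz m len[symmetric] by simp
  also have "\<dots> = gate 0 (A $$ (0,0)) (A $$ (0,1)) (B $$ (0,0)) (B $$ (0,1))
      (\<lambda>y. w $ basis_index (x @ y)) ([s, t] @ y)"
    using A B unfolding SU_2_iff
    by (cases s; cases t) (simp_all add: UNIV matchgate_index Let_def)
  also have "\<dots> = gate k (A $$ (0,0)) (A $$ (0,1)) (B $$ (0,0)) (B $$ (0,1))
      (\<lambda>y. w $ basis_index y) z"
    unfolding zz len[symmetric] gate_append ..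
  finally show ?thesis .
qed

lemma circuit_carrier:
  "U \<in> matchgate_circuits m \<Longrightarrow> U \<in> carrier_mat (2 ^ m) (2 ^ m)"
  by (induction rule: matchgate_circuits.induct)
     (auto simp: matchgates_def intro!: mult_carrier_mat apply_at_dims matchgate_carrier)

section \<open>Correspondence between circuit matrices and circuit maps\<close>

definition implements :: "nat \<Rightarrow> complex mat \<Rightarrow> ((bool list \<Rightarrow> complex) \<Rightarrow> bool list \<Rightarrow> complex) \<Rightarrow> bool"
  where "implements m U T \<longleftrightarrow> (\<forall>w z. w \<in> carrier_vec (2 ^ m) \<longrightarrow> length z = m \<longrightarrow>
     (U *\<^sub>v w) $ basis_index z = T (\<lambda>y. w $ basis_index y) z)"

lemma implements_one: "implements m (1\<^sub>m (2 ^ m)) (\<lambda>\<psi>. \<psi>)"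
  by (simp add: implements_def)

lemma implements_gate:
  assumes U: "U \<in> matchgate_circuits m" "implements m U T"
    and "A \<in> SU 2" "B \<in> SU 2" "Suc k < m"
  shows "implements m (apply_at m (Suc k) (matchgate A B) * U)
    (\<lambda>\<psi>. gate k (A $$ (0,0)) (A $$ (0,1)) (B $$ (0,0)) (B $$ (0,1)) (T \<psi>))"
  unfolding implements_def
proof (intro allI impI)
  fix w :: "complex vec" and z :: "bool list"
  assume w: "w \<in> carrier_vec (2 ^ m)" and z: "length z = m"
  have M: "apply_at m (Suc k) (matchgate A B) \<in> carrier_mat (2 ^ m) (2 ^ m)"
    using assms by (intro apply_at_dims matchgate_carrier) auto
  have Uw: "U *\<^sub>v w \<in> carrier_vec (2 ^ m)"
    using circuit_carrier[OF U(1)] w by auto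
  have "(apply_at m (Suc k) (matchgate A B) * U) *\<^sub>v w
      = apply_at m (Suc k) (matchgate A B) *\<^sub>v (U *\<^sub>v w)"
    using M circuit_carrier[OF U(1)] w by (rule assoc_mult_mat_vec)
  then show "((apply_at m (Suc k) (matchgate A B) * U) *\<^sub>v w) $ basis_index z
    = gate k (A $$ (0,0)) (A $$ (0,1)) (B $$ (0,0)) (B $$ (0,1)) (T (\<lambda>y. w $ basis_index y)) z"
    using apply_matchgate[OF assms(3-5) Uw z] U(2) w z
    by (auto simp: implements_def intro: gate_cong)
qed

lemma circuit_implements_map:
  assumes "U \<in> matchgate_circuits m"
  shows "\<exists>T. circuit_map m T \<and> implements m U T"
  using assms
proof (induction rule: matchgate_circuits.induct)
  case empty
  then show ?case using implements_one circuit_map.id by blast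
next
  case (gate U G k)
  then obtain T A B where T: "circuit_map m T" "implements m U T"
    and AB: "G = matchgate A B" "A \<in> SU 2" "B \<in> SU 2"
    by (auto simp: matchgates_def)
  obtain k' where k: "k = Suc k'" using gate by (cases k) auto
  have "circuit_map m
      (\<lambda>\<psi>. gate k' (A $$ (0,0)) (A $$ (0,1)) (B $$ (0,0)) (B $$ (0,1)) (T \<psi>))"
    using AB T gate k by (intro circuit_map.gate) (auto simp: SU_2_iff unit_pair_def)
  then show ?case
    using implements_gate[OF gate.hyps(1) T(2) AB(2,3), of k'] gate k AB by auto
qed

lemma map_implemented_by_circuit:
  assumes "circuit_map m T"
  shows "\<exists>U \<in> matchgate_circuits m. implements m U T"
  using assms
proof (induction rule: circuit_map.induct)
  case id
  then show ?case using implements_one matchgate_circuits.empty by blast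
next
  case (gate T k a b u v)
  then obtain U where U: "U \<in> matchgate_circuits m" "implements m U T" by blast
  define S where "S = (\<lambda>p q. mat_of_rows_list 2 [[p, q], [- cnj q, cnj p]])"
  have S: "S p q \<in> SU 2" "S p q $$ (0,0) = p" "S p q $$ (0,1) = q" if "unit_pair p q" for p q
    using that by (auto simp: SU_2_iff S_def mat_of_rows_list_def unit_pair_def)
  have "matchgate (S a b) (S u v) \<in> matchgates"
    using S gate by (auto simp: matchgates_def)
  then have "apply_at m (Suc k) (matchgate (S a b) (S u v)) * U \<in> matchgate_circuits m"
    using U gate by (intro matchgate_circuits.gate) auto
  then show ?case
    using implements_gate[OF U S(1) S(1), of a b u v k] gate S by auto
qed

section \<open>Majorana operators\<close>

text \<open>In the Jordan--Wigner representation the first argument lists the coefficients: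
  the pair \<open>(z, w)\<close> at position \<open>k\<close> stands for the \<open>2 \<times> 2\<close> matrix with off-diagonal
  entries \<open>z\<close> and \<open>w\<close> on qubit \<open>k\<close>, preceded by Pauli \<open>Z\<close> on all earlier qubits.\<close>

fun majorana :: "(complex \<times> complex) list \<Rightarrow> (bool list \<Rightarrow> complex) \<Rightarrow> bool list \<Rightarrow> complex" where
  "majorana ((z, w) # c) \<psi> (s # y) =
     (if s then - 1 else 1) * majorana c (\<lambda>x. \<psi> (s # x)) y + (if s then w else z) * \<psi> ((\<not> s) # y)"
| "majorana _ _ _ = 0"

lemma majorana_cong:
  assumes "\<And>z. length z = length y \<Longrightarrow> \<psi> z = \<phi> z"
  shows "majorana c \<psi> y = majorana c \<phi> y"
  using assms by (induction c \<psi> y arbitrary: \<phi> rule: majorana.induct) auto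

lemma majorana_linear:
  "majorana c (\<lambda>x. p * \<psi> x + q * \<phi> x) y = p * majorana c \<psi> y + q * majorana c \<phi> y"
proof (induction c \<psi> y arbitrary: \<phi> rule: majorana.induct)
  case (1 z w c \<psi> s y)
  show ?case by (simp only: majorana.simps 1) (simp add: algebra_simps)
qed auto

lemma gate_linear:
  "gate k a b u v (\<lambda>x. p * \<psi> x + q * \<phi> x) y = p * gate k a b u v \<psi> y + q * gate k a b u v \<phi> y"
proof (induction k a b u v \<psi> y arbitrary: \<phi> rule: gate.induct)
  case (2 k a b u v \<psi> s y)
  show ?case by (simp only: gate.simps 2)
qed (auto simp: Let_def algebra_simps)

lemma majorana_zero [simp]: "majorana (replicate m (0, 0)) \<psi> y = 0"
proof (induction m arbitrary: \<psi> y)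
  case (Suc m)
  then show ?case by (cases y) auto
qed simp

lemma majorana_null [simp]: "majorana c (\<lambda>x. 0) y = 0"
  using majorana_linear[of c 0 "\<lambda>x. 0" 0 "\<lambda>x. 0" y] by simp

text \<open>Majorana operators on two adjacent qubits change the parity of the two qubits. As a map from odd to
  even parity such an operator is the matrix \<open>M\<close> with rows \<open>(z', z)\<close> and \<open>(w, -w')\<close>, as a map
  from even to odd parity it is minus the adjugate of \<open>M\<close>. Conjugation turns \<open>M\<close> into
  \<open>A\<^sup>* M B\<close>, and since \<open>A, B\<close> are in \<open>SU 2\<close>, its adjugate into \<open>B\<^sup>* adj(M) A\<close>.\<close>

lemma majorana_gate_0:
  assumes "unit_pair a b" "unit_pair u v"
  shows "\<exists>z1 w1 z1' w1'. \<forall>c \<psi> s t y.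
    majorana ((z, w) # (z', w') # c) (gate 0 a b u v \<psi>) (s # t # y)
    = gate 0 a b u v (majorana ((z1, w1) # (z1', w1') # c) \<psi>) (s # t # y)"
proof -
  \<comment> \<open>These are the entries of M B, row by row; multiplying by the adjoint of A from
    the left gives \<open>z1'\<close>, \<open>z1\<close> in the upper row and \<open>w1\<close>,
    \<open>- w1'\<close> in the lower one.\<close>
  let ?p = "z' * u - z * cnj v" and ?q = "z' * v + z * cnj u"
  let ?r = "w * u + w' * cnj v" and ?s = "w * v - w' * cnj u"
  have ab: "a * cnj a + b * cnj b = 1" and uv: "u * cnj u + v * cnj v = 1"
    using assms by (auto simp: unit_pair_def)
  define z1' where "z1' = cnj a * ?p - b * ?r"
  define z1 where "z1 = cnj a * ?q - b * ?s"
  define w1 where "w1 = cnj b * ?p + a * ?r"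
  define w1' where "w1' = - (cnj b * ?q + a * ?s)"
  \<comment> \<open>The tail \<open>c\<close> is the same on both sides: operators on later qubits
    carry Z Z on these two qubits, which is their parity, and the gate preserves parity.\<close>
  have "majorana ((z, w) # (z', w') # c) (gate 0 a b u v \<psi>) (s # t # y)
    = gate 0 a b u v (majorana ((z1, w1) # (z1', w1') # c) \<psi>) (s # t # y)" for c \<psi> s t y
  proof -
    let ?\<phi> = "\<lambda>s t. \<psi> (s # t # y)"
    have lin: "majorana c (\<lambda>x. p * \<psi> x - q * \<phi> x) y = p * majorana c \<psi> y - q * majorana c \<phi> y"
      for p q \<psi> \<phi>
      using majorana_linear[of c p \<psi> "- q" \<phi> y] by simp
    show ?thesis
      using ab uv
      by (cases s; cases t; simp add: majorana_linear lin Let_def z1_def z1'_def w1_def w1'_def)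
         Groebner_Basis.algebra+
  qed
  then show ?thesis by blast
qed

text \<open>The conjugated operator is given by an intertwining relation, so the inverse of a gate
  never appears. A gate on later qubits is linear and commutes with the sign and the flip of the
  first qubit, so \<open>(z, w)\<close> stays unchanged in the induction step.\<close>

lemma majorana_gate:
  assumes "unit_pair a b" "unit_pair u v" "Suc k < length c"
  shows "\<exists>c'. length c' = length c \<and> (\<forall>\<psi> y. length y = length c \<longrightarrow>
    majorana c (gate k a b u v \<psi>) y = gate k a b u v (majorana c' \<psi>) y)"
  using assms(3)
proof (induction k arbitrary: c)
  case 0
  then obtain z w z' w' d where c: "c = (z, w) # (z', w') # d"
    by (auto simp: Suc_less_eq2 length_Suc_conv neq_Nil_conv)
  from majorana_gate_0[OF assms(1,2)] obtain z1 w1 z1' w1' where *: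
    "\<And>c \<psi> s t y. majorana ((z, w) # (z', w') # c) (gate 0 a b u v \<psi>) (s # t # y)
    = gate 0 a b u v (majorana ((z1, w1) # (z1', w1') # c) \<psi>) (s # t # y)" by meson
  show ?case
    by (rule exI[of _ "(z1, w1) # (z1', w1') # d"])
       (auto simp: c length_Suc_conv * simp del: majorana.simps gate.simps)
next
  case (Suc k)
  then obtain z w d where c: "c = (z, w) # d" by (cases c) auto
  then obtain d' where d: "length d' = length d" "\<And>\<psi> y. length y = length d \<Longrightarrow>
      majorana d (gate k a b u v \<psi>) y = gate k a b u v (majorana d' \<psi>) y"
    using Suc.IH[of d] Suc.prems by auto
  have "majorana c (gate (Suc k) a b u v \<psi>) y = gate (Suc k) a b u v (majorana ((z, w) # d') \<psi>) y"
    if y: "length y = length c" for \<psi> y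
  proof -
    obtain s x where sx: "y = s # x" "length x = length d" using y c by (cases y) auto
    show ?thesis
      by (simp add: c sx d(2) gate_linear)
  qed
  then show ?case using d(1) c by (intro exI[of _ "(z, w) # d'"]) auto
qed

lemma majorana_circuit:
  assumes "circuit_map m T" "length c = m"
  shows "\<exists>c'. length c' = m \<and>
    (\<forall>\<psi> y. length y = m \<longrightarrow> majorana c (T \<psi>) y = T (majorana c' \<psi>) y)"
  using assms
proof (induction arbitrary: c rule: circuit_map.induct)
  case id
  then show ?case by auto
next
  case (gate T k a b u v)
  obtain d where d: "length d = m" "\<And>\<psi> y. length y = m \<Longrightarrow>
      majorana c (gate k a b u v \<psi>) y = gate k a b u v (majorana d \<psi>) y"
    using majorana_gate[of a b u v k c] gate by auto
  obtain e where e: "length e = m" "\<And>\<psi> y. length y = m \<Longrightarrow> majorana d (T \<psi>) y = T (majorana e \<psi>) y"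
    using gate.IH[OF d(1)] by auto
  have "majorana c (gate k a b u v (T \<psi>)) y = gate k a b u v (T (majorana e \<psi>)) y"
    if "length y = m" for \<psi> y
    using that by (simp add: d e cong: gate_cong)
  then show ?case using e(1) by blast
qed

definition ket :: "bool list \<Rightarrow> bool list \<Rightarrow> complex" where
  "ket x y = of_bool (y = x)"

text \<open>Two flips lead back to \<open>x\<close> only if they hit the same qubit, and then the
  signs from the earlier qubits cancel.\<close>

lemma majorana_majorana_ket:
  assumes "length c = length x" "length d = length x"
  shows "majorana c (majorana d (ket x)) x
    = (\<Sum>k<length x. if x ! k then snd (c ! k) * fst (d ! k) else fst (c ! k) * snd (d ! k))"
  using assms
proof (induction x arbitrary: c d)
  case (Cons s x)
  obtain z w c0 where c: "c = (z, w) # c0" using Cons.prems by (cases c) auto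
  obtain z' w' d0 where d: "d = (z', w') # d0" using Cons.prems by (cases d) auto
  have ket: "ket (s # x) (s # y) = ket x y" "ket (s # x) ((\<not> s) # y) = 0"
    "ket (False # x) (True # y) = 0" "ket (True # x) (False # y) = 0" "ket x x = 1" for y
    by (auto simp: ket_def)
  have split: "majorana c (majorana d (ket (s # x))) (s # x)
      = majorana c0 (majorana d0 (ket x)) x + (if s then w * z' else z * w')"
  proof -
    \<comment> \<open>The summand \<open>0 * 0\<close> only gives the function the shape required by
      \<open>majorana_linear\<close>.\<close>
    have inner: "(\<lambda>y. majorana d (ket (s # x)) (s # y)) =
        (\<lambda>y. (if s then - 1 else 1) * majorana d0 (ket x) y + 0 * 0)"
      using ket(1,2) by (cases s) (simp_all add: d ket)
    have outer: "majorana d (ket (s # x)) ((\<not> s) # x) = (if s then z' else w')"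
      using ket(1,2) by (cases s) (simp_all add: d ket)
    show ?thesis
      unfolding c majorana.simps inner outer
      using majorana_linear[of c0 _ _ 0 "\<lambda>_. 0"] by auto
  qed
  show ?case
    unfolding split using Cons.IH[of c0 d0] Cons.prems
    by (simp add: c d sum.lessThan_Suc_shift del: sum.lessThan_Suc cong: if_cong)
qed simp

section \<open>Expectation of Pauli Z on the first qubit\<close>

definition ip :: "nat \<Rightarrow> (bool list \<Rightarrow> complex) \<Rightarrow> (bool list \<Rightarrow> complex) \<Rightarrow> complex" where
  "ip m \<phi> \<psi> = (\<Sum>y | length y = m. cnj (\<phi> y) * \<psi> y)"

lemma ip_Suc:
  "ip (Suc m) \<phi> \<psi> = ip m (\<lambda>y. \<phi> (False # y)) (\<lambda>y. \<psi> (False # y))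
     + ip m (\<lambda>y. \<phi> (True # y)) (\<lambda>y. \<psi> (True # y))"
  unfolding ip_def by (rule sum_bit_strings_Suc)

lemma ip_cong:
  assumes "\<And>y. length y = m \<Longrightarrow> \<phi> y = \<phi>' y" "\<And>y. length y = m \<Longrightarrow> \<psi> y = \<psi>' y"
  shows "ip m \<phi> \<psi> = ip m \<phi>' \<psi>'"
  using assms by (simp add: ip_def)

lemma ip_ket:
  assumes "length x = m"
  shows "ip m (ket x) \<psi> = \<psi> x"
proof -
  have "ip m (ket x) \<psi> = (\<Sum>y | length y = m. if y = x then \<psi> y else 0)"
    unfolding ip_def by (intro sum.cong) (auto simp: ket_def)
  then show ?thesis using assms by simp
qed

section \<open>Invariance of the inner product under circuits\<close>

lemma unit_pair_isometry:
  assumes "unit_pair a b"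
  shows "cnj (a * x + b * y) * (a * x' + b * y')
    + cnj (- cnj b * x + cnj a * y) * (- cnj b * x' + cnj a * y') = cnj x * x' + cnj y * y'"
proof -
  have "cnj (a * x + b * y) * (a * x' + b * y')
    + cnj (- cnj b * x + cnj a * y) * (- cnj b * x' + cnj a * y')
    = (a * cnj a + b * cnj b) * (cnj x * x' + cnj y * y')"
    unfolding complex_cnj_add complex_cnj_mult complex_cnj_minus complex_cnj_cnj
    by Groebner_Basis.algebra
  then show ?thesis using assms by (simp only: unit_pair_def mult_1)
qed

lemma ip_gate:
  assumes ab: "unit_pair a b" and uv: "unit_pair u v" and "Suc k < m"
  shows "ip m (gate k a b u v \<phi>) (gate k a b u v \<psi>) = ip m \<phi> \<psi>"
  using assms(3)
proof (induction k arbitrary: m \<phi> \<psi>)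
  case 0
  then obtain m' where m: "m = Suc (Suc m')" by (auto dest!: less_imp_Suc_add)
  let ?X = "\<lambda>s t y. cnj (gate 0 a b u v \<phi> (s # t # y)) * gate 0 a b u v \<psi> (s # t # y)"
  let ?Y = "\<lambda>s t y. cnj (\<phi> (s # t # y)) * \<psi> (s # t # y)"
  have even: "?X False False y + ?X True True y = ?Y False False y + ?Y True True y" for y
    using unit_pair_isometry[OF ab, of "\<phi> (False # False # y)" "\<phi> (True # True # y)"
        "\<psi> (False # False # y)" "\<psi> (True # True # y)"]
    by (simp only: gate.simps Let_def if_True if_False simp_thms)
  have odd: "?X False True y + ?X True False y = ?Y False True y + ?Y True False y" for y
    using unit_pair_isometry[OF uv, of "\<phi> (False # True # y)" "\<phi> (True # False # y)"
        "\<psi> (False # True # y)" "\<psi> (True # False # y)"]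
    by (simp only: gate.simps Let_def if_True if_False simp_thms)
  \<comment> \<open>The four sums come in the order 00, 01, 10, 11: the outer two form the even
    sector, the inner two the odd one, and the gate preserves each sector separately.\<close>
  have pair: "p + q + (r + s) = p' + q' + (r' + s')"
    if "p + s = p' + s'" "q + r = q' + r'" for p q r s p' q' r' s' :: complex
  proof -
    have "p + q + (r + s) = (p + s) + (q + r)" by simp
    also have "\<dots> = p' + q' + (r' + s')" by (simp add: that)
    finally show ?thesis .
  qed
  show ?case
    unfolding m ip_Suc unfolding ip_def sum.distrib[symmetric]
    by (intro sum.cong refl pair even odd)
next
  case (Suc k)
  then obtain m' where m: "m = Suc m'" by (cases m) auto
  then show ?case using Suc.IH[of m'] Suc.prems by (simp add: ip_Suc)
qed

lemma ip_circuit: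
  assumes "circuit_map m T"
  shows "ip m (T \<phi>) (T \<psi>) = ip m \<phi> \<psi>"
  using assms by (induction rule: circuit_map.induct) (simp_all add: ip_gate)

section \<open>Measurement of the first qubit\<close>

definition qubit_prob :: "nat \<Rightarrow> (bool list \<Rightarrow> complex) \<Rightarrow> bool \<Rightarrow> real" where
  "qubit_prob m \<psi> b = (\<Sum>y | length y = m. (cmod (\<psi> (b # y)))\<^sup>2)"

definition pauli_z :: "(bool list \<Rightarrow> complex) \<Rightarrow> bool list \<Rightarrow> complex" where
  "pauli_z \<psi> y = of_real (pm (hd y)) * \<psi> y"

text \<open>Here \<open>m\<close> counts the qubits behind the first one, so the state has
  \<open>Suc m\<close> qubits.\<close>

definition z_expectation :: "nat \<Rightarrow> (bool list \<Rightarrow> complex) \<Rightarrow> real" where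
  "z_expectation m \<psi> = qubit_prob m \<psi> False - qubit_prob m \<psi> True"

lemma pm_simps [simp]: "pm False = 1" "pm True = -1"
  by (simp_all add: pm_def)

lemma qubit_prob_ip: "of_real (qubit_prob m \<psi> b) = ip m (\<lambda>y. \<psi> (b # y)) (\<lambda>y. \<psi> (b # y))"
  by (simp add: qubit_prob_def ip_def complex_norm_square mult.commute del: of_real_power)

lemma z_expectation_ip: "of_real (z_expectation m \<psi>) = ip (Suc m) \<psi> (pauli_z \<psi>)"
  by (simp add: z_expectation_def qubit_prob_ip ip_Suc pauli_z_def) (simp add: ip_def sum_negf)

lemma qubit_prob_total: "of_real (qubit_prob m \<psi> False + qubit_prob m \<psi> True) = ip (Suc m) \<psi> \<psi>"
  by (simp add: qubit_prob_ip ip_Suc)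

lemma qubit_prob_circuit_total:
  assumes "circuit_map (Suc m) T" "length x = Suc m"
  shows "qubit_prob m (T (ket x)) False + qubit_prob m (T (ket x)) True = 1"
proof -
  have "ip (Suc m) (T (ket x)) (T (ket x)) = 1"
    using assms by (simp add: ip_circuit ip_ket) (simp add: ket_def)
  then show ?thesis
    using qubit_prob_total[of m "T (ket x)"] by (metis of_real_eq_1_iff)
qed

lemma qubit_prob_eq:
  assumes "circuit_map (Suc m) T" "length x = Suc m"
  shows "qubit_prob m (T (ket x)) b = (1 + pm b * z_expectation m (T (ket x))) / 2"
  using qubit_prob_circuit_total[OF assms] by (cases b) (simp_all add: z_expectation_def)

lemma qubit_prob_nonneg: "qubit_prob m \<psi> b \<ge> 0"
  by (simp add: qubit_prob_def sum_nonneg)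

text \<open>On the first qubit Z = (i Y) X; the pair \<open>(1, -1)\<close> is i Y and the pair
  \<open>(1, 1)\<close> is X.\<close>

lemma pauli_z_majorana:
  assumes "length y = Suc m"
  shows "pauli_z \<psi> y
    = majorana ((1, -1) # replicate m (0, 0)) (majorana ((1, 1) # replicate m (0, 0)) \<psi>) y"
proof -
  obtain s x where "y = s # x" using assms by (cases y) auto
  then show ?thesis by (cases s) (simp_all add: pauli_z_def)
qed

text \<open>Both Majorana factors of Z are moved through the circuit, which then cancels in the
  inner product and leaves a diagonal entry.\<close>

lemma z_expectation_circuit_complex:
  assumes T: "circuit_map (Suc m) T"
  shows "\<exists>c d. length c = Suc m \<and> length d = Suc m \<and> (\<forall>x. length x = Suc m \<longrightarrow>
    of_real (z_expectation m (T (ket x))) = majorana c (majorana d (ket x)) x)"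
proof -
  obtain c where c: "length c = Suc m" "\<And>\<psi> y. length y = Suc m \<Longrightarrow>
      majorana ((1, -1) # replicate m (0, 0)) (T \<psi>) y = T (majorana c \<psi>) y"
    using majorana_circuit[OF T, of "(1, -1) # replicate m (0, 0)"] by auto
  obtain d where d: "length d = Suc m" "\<And>\<psi> y. length y = Suc m \<Longrightarrow>
      majorana ((1, 1) # replicate m (0, 0)) (T \<psi>) y = T (majorana d \<psi>) y"
    using majorana_circuit[OF T, of "(1, 1) # replicate m (0, 0)"] by auto
  have "of_real (z_expectation m (T (ket x))) = majorana c (majorana d (ket x)) x"
    if x: "length x = Suc m" for x
  proof -
    have "pauli_z (T (ket x)) y = T (majorana c (majorana d (ket x))) y" if y: "length y = Suc m" for y
    proof -
      have "pauli_z (T (ket x)) y = majorana ((1, -1) # replicate m (0, 0))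
          (majorana ((1, 1) # replicate m (0, 0)) (T (ket x))) y"
        by (rule pauli_z_majorana[OF y])
      also have "\<dots> = majorana ((1, -1) # replicate m (0, 0)) (T (majorana d (ket x))) y"
        by (rule majorana_cong) (simp only: d(2) y)
      also have "\<dots> = T (majorana c (majorana d (ket x))) y"
        by (rule c(2)[OF y])
      finally show ?thesis .
    qed
    then have "of_real (z_expectation m (T (ket x)))
        = ip (Suc m) (T (ket x)) (T (majorana c (majorana d (ket x))))"
      unfolding z_expectation_ip by (intro ip_cong) auto
    then show ?thesis by (simp add: ip_circuit[OF T] ip_ket x)
  qed
  then show ?thesis using c(1) d(1) by blast
qed

lemma z_expectation_affine:
  assumes T: "circuit_map (Suc m) T"
  shows "\<exists>l \<theta>. \<forall>x. length x = Suc m \<longrightarrow>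
    z_expectation m (T (ket x)) = (\<Sum>k<Suc m. l k * pm (x ! k)) + \<theta>"
proof -
  obtain c d where cd: "length c = Suc m" "length d = Suc m" "\<And>x. length x = Suc m \<Longrightarrow>
    of_real (z_expectation m (T (ket x))) = majorana c (majorana d (ket x)) x"
    using z_expectation_circuit_complex[OF T] by blast
  \<comment> \<open>Only the whole sum is known to be real, so real parts are taken termwise. A
    function of a bit \<open>b\<close> with value \<open>p k\<close> at 0 and \<open>q k\<close> at
    1 is \<open>(p k - q k) / 2 * pm b + (p k + q k) / 2\<close>.\<close>
  define p where "p k = Re (fst (c ! k) * snd (d ! k))" for k
  define q where "q k = Re (snd (c ! k) * fst (d ! k))" for k
  have "z_expectation m (T (ket x))
      = (\<Sum>k<Suc m. (p k - q k) / 2 * pm (x ! k)) + (\<Sum>k<Suc m. (p k + q k) / 2)"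
    if x: "length x = Suc m" for x
  proof -
    have "z_expectation m (T (ket x)) = Re (majorana c (majorana d (ket x)) x)"
      using cd(3)[OF x] by (metis Re_complex_of_real)
    also have "\<dots> = (\<Sum>k<Suc m. if x ! k then q k else p k)"
      unfolding majorana_majorana_ket[of c x d, unfolded x, OF cd(1,2)] Re_sum
      by (intro sum.cong) (auto simp: p_def q_def)
    also have "\<dots> = (\<Sum>k<Suc m. (p k - q k) / 2 * pm (x ! k) + (p k + q k) / 2)"
      by (intro sum.cong) (auto simp: field_simps)
    finally show ?thesis by (simp only: sum.distrib)
  qed
  then show ?thesis by (intro exI[of _ "\<lambda>k. (p k - q k) / 2"] exI[of _ "\<Sum>k<Suc m. (p k + q k) / 2"]) blast
qed

text \<open>At a suitable vertex of the cube no term has the sign opposite to that of \<theta>, so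
  the absolute value there is the sum of all absolute values.\<close>

lemma affine_coefficients_bound:
  assumes "\<And>x. length x = n \<Longrightarrow> \<bar>(\<Sum>k<n. l k * pm (x ! k)) + \<theta>\<bar> \<le> C"
  shows "(\<Sum>k<n. \<bar>l k\<bar>) + \<bar>\<theta>\<bar> \<le> C"
proof -
  define s :: real where "s = (if \<theta> < 0 then -1 else 1)"
  define x where "x = map (\<lambda>k. s * l k < 0) [0..<n]"
  have "l k * pm (x ! k) = s * \<bar>l k\<bar>" if "k < n" for k
    using that by (cases "s * l k < 0") (auto simp: x_def s_def split: if_splits)
  then have "(\<Sum>k<n. l k * pm (x ! k)) + \<theta> = s * ((\<Sum>k<n. \<bar>l k\<bar>) + \<bar>\<theta>\<bar>)"
    by (simp add: sum_distrib_left distrib_left) (simp add: s_def)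
  moreover have "\<bar>s * ((\<Sum>k<n. \<bar>l k\<bar>) + \<bar>\<theta>\<bar>)\<bar> = (\<Sum>k<n. \<bar>l k\<bar>) + \<bar>\<theta>\<bar>"
    by (simp add: abs_mult s_def sum_nonneg abs_of_nonneg)
  moreover have "length x = n" by (simp add: x_def)
  ultimately show ?thesis using assms[of x] by simp
qed

lemma circuit_expectation_affine:
  assumes T: "circuit_map (Suc m) T" and n: "n \<le> Suc m"
  shows "\<exists>l \<theta>. (\<Sum>k<n. \<bar>l k\<bar>) + \<bar>\<theta>\<bar> \<le> 1 \<and> (\<forall>x. length x = n \<longrightarrow>
    z_expectation m (T (ket (x @ replicate (Suc m - n) False))) = (\<Sum>k<n. l k * pm (x ! k)) + \<theta>)"
proof -
  obtain l \<theta> where l: "\<And>x. length x = Suc m \<Longrightarrow>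
    z_expectation m (T (ket x)) = (\<Sum>k<Suc m. l k * pm (x ! k)) + \<theta>"
    using z_expectation_affine[OF T] by blast
  \<comment> \<open>An ancilla in 0 has sign \<open>pm False = 1\<close>, so its coefficient enters
    as a constant.\<close>
  define \<theta>' where "\<theta>' = (\<Sum>k=n..<Suc m. l k) + \<theta>"
  have eq: "z_expectation m (T (ket (x @ replicate (Suc m - n) False))) = (\<Sum>k<n. l k * pm (x ! k)) + \<theta>'"
    if x: "length x = n" for x
  proof -
    let ?y = "x @ replicate (Suc m - n) False"
    have "(\<Sum>k<Suc m. l k * pm (?y ! k))
        = (\<Sum>k<n. l k * pm (?y ! k)) + (\<Sum>k=n..<Suc m. l k * pm (?y ! k))"
      using n sum.atLeastLessThan_concat[of 0 n "Suc m" "\<lambda>k. l k * pm (?y ! k)"]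
      by (simp only: atLeast0LessThan zero_le)
    also have "(\<Sum>k<n. l k * pm (?y ! k)) = (\<Sum>k<n. l k * pm (x ! k))"
      using x by (intro sum.cong) (auto simp: nth_append)
    also have "(\<Sum>k=n..<Suc m. l k * pm (?y ! k)) = (\<Sum>k=n..<Suc m. l k)"
      using x by (intro sum.cong) (auto simp: nth_append)
    finally show ?thesis using l[of ?y] x n by (simp add: \<theta>'_def)
  qed
  have "\<bar>(\<Sum>k<n. l k * pm (x ! k)) + \<theta>'\<bar> \<le> 1" if x: "length x = n" for x
  proof -
    let ?y = "x @ replicate (Suc m - n) False"
    have "length ?y = Suc m" using x n by simp
    note total = qubit_prob_circuit_total[OF T this]
    show ?thesis
      using total qubit_prob_nonneg[of m "T (ket ?y)" False] qubit_prob_nonneg[of m "T (ket ?y)" True]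
      unfolding eq[OF x, symmetric] z_expectation_def by linarith
  qed
  then show ?thesis using eq affine_coefficients_bound by blast
qed

section \<open>From amplitude functions back to outcome probabilities\<close>

lemma basis_state_index:
  assumes "length y = length x"
  shows "basis_state x $ basis_index y = ket x y"
  using basis_index_less[of x] basis_index_less[of y] basis_index_inj[of y x] assms
  by (auto simp: basis_state_def ket_def)

lemma circuit_map_cong:
  assumes "circuit_map m T" "\<And>y. length y = m \<Longrightarrow> \<phi> y = \<psi> y" "length y = m"
  shows "T \<phi> y = T \<psi> y"
  using assms by (induction arbitrary: y rule: circuit_map.induct) (auto intro: gate_cong)

lemma first_qubit_prob_eq:
  assumes T: "circuit_map (Suc m) T" and U: "implements (Suc m) U T" and x: "length x = Suc m"
  shows "first_qubit_prob (Suc m) (U *\<^sub>v basis_state x) b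
    = (1 + pm b * z_expectation m (T (ket x))) / 2"
proof -
  have entry: "(U *\<^sub>v basis_state x) $ basis_index y = T (ket x) y" if "length y = Suc m" for y
  proof -
    have "basis_state x \<in> carrier_vec (2 ^ Suc m)"
      by (simp add: basis_state_def x)
    then have "(U *\<^sub>v basis_state x) $ basis_index y = T (\<lambda>y. basis_state x $ basis_index y) y"
      using U that unfolding implements_def by blast
    also have "\<dots> = T (ket x) y"
      using basis_state_index x by (intro circuit_map_cong[OF T]) (auto simp: that)
    finally show ?thesis .
  qed
  have set: "{y. length y = Suc m \<and> hd y = b} = (#) b ` {y. length y = m}"
    by (auto simp: length_Suc_conv)
  have "first_qubit_prob (Suc m) (U *\<^sub>v basis_state x) b = qubit_prob m (T (ket x)) b"
    unfolding first_qubit_prob_def set qubit_prob_def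
    by (subst sum.reindex) (auto simp: entry)
  then show ?thesis using qubit_prob_eq[OF T x] by simp
qed

section \<open>Rounding the coefficients\<close>

lemma abs_pm [simp]: "\<bar>pm b\<bar> = 1"
  by (cases b) simp_all

lemma sgn_mult_pm_pos: "pm b * t > 0 \<Longrightarrow> pm b = sgn t"
  by (cases b) (auto simp: sgn_if)

text \<open>Serves two purposes: for a circuit, with \<open>S = 1\<close>, it bounds the weight; for
  an arbitrary threshold gate only the existence of an integer representation is taken from
  it.\<close>

lemma integer_representation_of_margin:
  assumes \<delta>: "\<delta> > 0"
    and margin: "\<And>x. length x = n \<Longrightarrow> pm (f x) * ((\<Sum>k<n. l k * pm (x ! k)) + \<theta>) \<ge> \<delta>"
    and S: "(\<Sum>k<n. \<bar>l k\<bar>) + \<bar>\<theta>\<bar> \<le> S"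
  shows "\<exists>w \<theta>'. integer_representation n f w \<theta>' \<and>
    (\<Sum>k<n. \<bar>w k\<bar>) + \<bar>\<theta>'\<bar> \<le> (real n + 1) * (S / \<delta> + 1)"
proof -
  define N where "N = (real n + 1) / \<delta>"
  define w where "w k = (of_int (round (N * l k)) :: real)" for k
  define \<theta>' where "\<theta>' = (of_int (round (N * \<theta>)) :: real)"
  have N: "N > 0" "N * \<delta> = real n + 1" using \<delta> by (simp_all add: N_def)
  have w: "\<bar>w k - N * l k\<bar> \<le> 1 / 2" for k
    unfolding w_def by (rule of_int_round_abs_le)
  have \<theta>': "\<bar>\<theta>' - N * \<theta>\<bar> \<le> 1 / 2"
    unfolding \<theta>'_def by (rule of_int_round_abs_le)
  have "pm (f x) = sgn ((\<Sum>k<n. w k * pm (x ! k)) + \<theta>')" if x: "length x = n" for x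
  proof (rule sgn_mult_pm_pos)
    define t where "t = (\<Sum>k<n. l k * pm (x ! k)) + \<theta>"
    define t' where "t' = (\<Sum>k<n. w k * pm (x ! k)) + \<theta>'"
    have "t' - N * t = (\<Sum>k<n. (w k - N * l k) * pm (x ! k)) + (\<theta>' - N * \<theta>)"
      by (simp add: t_def t'_def algebra_simps sum_subtractf sum_distrib_left)
    also have "\<bar>\<dots>\<bar> \<le> (\<Sum>k<n. \<bar>(w k - N * l k) * pm (x ! k)\<bar>) + \<bar>\<theta>' - N * \<theta>\<bar>"
      using sum_abs[of "\<lambda>k. (w k - N * l k) * pm (x ! k)" "{..<n}"] by linarith
    also have "\<dots> \<le> (\<Sum>k<n. 1 / 2) + 1 / 2"
      using w \<theta>' by (intro add_mono sum_mono) (auto simp: abs_mult)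
    finally have close: "\<bar>t' - N * t\<bar> \<le> (real n + 1) / 2" by (simp add: field_simps)
    have "real n + 1 \<le> N * (pm (f x) * t)"
      using mult_left_mono[OF margin[OF x], of N] N by (simp add: t_def)
    moreover have "\<bar>pm (f x) * t' - N * (pm (f x) * t)\<bar> \<le> (real n + 1) / 2"
      using close by (cases "f x") (simp_all add: abs_minus_commute)
    moreover have "0 < r'" if "c + 1 \<le> r" "\<bar>r' - r\<bar> \<le> (c + 1) / 2" "0 \<le> c" for r r' c :: real
    proof -
      have "- (r' - r) \<le> (c + 1) / 2" using that(2) by (rule order_trans[OF abs_ge_minus_self])
      then show ?thesis using that(1,3) by (simp add: field_simps)
    qed
    ultimately show "pm (f x) * ((\<Sum>k<n. w k * pm (x ! k)) + \<theta>') > 0"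
      unfolding t'_def[symmetric] using of_nat_0_le_iff by blast
  qed
  then have "integer_representation n f w \<theta>'"
    by (simp add: integer_representation_def ltg_representation_def w_def \<theta>'_def)
  moreover have "(\<Sum>k<n. \<bar>w k\<bar>) + \<bar>\<theta>'\<bar> \<le> (real n + 1) * (S / \<delta> + 1)"
  proof -
    have "\<bar>w k\<bar> \<le> N * \<bar>l k\<bar> + 1 / 2" for k
      using w[of k] N(1) abs_mult[of N "l k"] abs_triangle_ineq[of "w k - N * l k" "N * l k"] by simp
    then have "(\<Sum>k<n. \<bar>w k\<bar>) \<le> (\<Sum>k<n. N * \<bar>l k\<bar> + 1 / 2)"
      by (rule sum_mono)
    moreover have "\<bar>\<theta>'\<bar> \<le> N * \<bar>\<theta>\<bar> + 1 / 2"
      using \<theta>' N(1) abs_mult[of N \<theta>] abs_triangle_ineq[of "\<theta>' - N * \<theta>" "N * \<theta>"] by simp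
    ultimately have "(\<Sum>k<n. \<bar>w k\<bar>) + \<bar>\<theta>'\<bar> \<le> N * ((\<Sum>k<n. \<bar>l k\<bar>) + \<bar>\<theta>\<bar>) + (real n + 1) / 2"
      by (simp add: sum.distrib sum_distrib_left distrib_left add_divide_distrib)
    also have "\<dots> \<le> N * S + (real n + 1)"
      using N(1) by (intro add_mono mult_left_mono[OF S]) auto
    also have "\<dots> = (real n + 1) * (S / \<delta> + 1)"
      by (simp add: N_def algebra_simps add_divide_distrib)
    finally show ?thesis .
  qed
  ultimately show ?thesis by blast
qed

text \<open>There are finitely many inputs, so the least absolute value of the threshold function is
  a positive margin, and rounding applies.\<close>

lemma linear_threshold_gate_integer_representation:
  assumes "linear_threshold_gate n f"
  shows "\<exists>w \<theta>. integer_representation n f w \<theta>"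
proof -
  obtain l \<theta> where l: "\<And>x. length x = n \<Longrightarrow> pm (f x) = sgn ((\<Sum>k<n. l k * pm (x ! k)) + \<theta>)"
    using assms by (auto simp: linear_threshold_gate_def ltg_representation_def)
  define g where "g x = pm (f x) * ((\<Sum>k<n. l k * pm (x ! k)) + \<theta>)" for x
  have g: "g x > 0" if "length x = n" for x
  proof -
    let ?t = "(\<Sum>k<n. l k * pm (x ! k)) + \<theta>"
    have "sgn ?t \<noteq> 0" using l[OF that] abs_pm[of "f x"] by (metis abs_0 zero_neq_one)
    moreover have "g x = \<bar>?t\<bar>" unfolding g_def l[OF that] by (simp add: abs_sgn mult.commute)
    ultimately show ?thesis by (simp add: sgn_zero_iff)
  qed
  define \<delta> where "\<delta> = Min (g ` {x. length x = n})"
  have ne: "{x :: bool list. length x = n} \<noteq> {}" by (auto intro: exI[of _ "replicate n True"])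
  have "\<delta> > 0" using g ne by (simp add: \<delta>_def)
  moreover have "g x \<ge> \<delta>" if "length x = n" for x using that by (simp add: \<delta>_def)
  ultimately show ?thesis
    using integer_representation_of_margin[of \<delta> n f l \<theta>] unfolding g_def by blast
qed

lemma integer_weight_of_circuit:
  assumes U: "U \<in> matchgate_circuits m" and n: "1 \<le> n" "n \<le> m"
    and f: "computes_with_prob m U n f p" and p: "1 / 2 < p"
  shows "linear_threshold_gate n f"
    and "real (integer_weight n f) \<le> (real n + 1) * (1 / (2 * p - 1) + 1)"
proof -
  obtain m' where m: "m = Suc m'" using n by (cases m) auto
  obtain T where T: "circuit_map (Suc m') T" "implements (Suc m') U T"
    using circuit_implements_map[OF U] m by auto
  obtain l \<theta> where l: "(\<Sum>k<n. \<bar>l k\<bar>) + \<bar>\<theta>\<bar> \<le> 1" "\<And>x. length x = n \<Longrightarrow>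
    z_expectation m' (T (ket (x @ replicate (Suc m' - n) False))) = (\<Sum>k<n. l k * pm (x ! k)) + \<theta>"
    using circuit_expectation_affine[OF T(1)] n m by blast
  \<comment> \<open>The outcome \<open>f x\<close> has probability (1 + r) / 2, where r is
    \<open>pm (f x)\<close> times the expectation; this is at least \<open>p\<close> exactly if r is
    at least \<open>2 * p - 1\<close>.\<close>
  have "2 * p - 1 \<le> pm (f x) * ((\<Sum>k<n. l k * pm (x ! k)) + \<theta>)" if x: "length x = n" for x
  proof -
    have "p \<le> first_qubit_prob m (U *\<^sub>v basis_state (x @ replicate (m - n) False)) (f x)"
      using f x by (simp add: computes_with_prob_def)
    then show ?thesis
      using first_qubit_prob_eq[OF T, of "x @ replicate (m - n) False" "f x"] l(2)[OF x] x n m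
      by simp
  qed
  then obtain w \<theta>' where w: "integer_representation n f w \<theta>'"
    "(\<Sum>k<n. \<bar>w k\<bar>) + \<bar>\<theta>'\<bar> \<le> (real n + 1) * (1 / (2 * p - 1) + 1)"
    using integer_representation_of_margin[of "2 * p - 1" n f l \<theta> 1] l(1) p by auto
  then show "linear_threshold_gate n f"
    by (auto simp: integer_representation_def linear_threshold_gate_def)
  show "real (integer_weight n f) \<le> (real n + 1) * (1 / (2 * p - 1) + 1)"
    using integer_weight_is_minimum(1)[OF w(1)] w(2) by linarith
qed

section \<open>Circuits with prescribed coefficients\<close>

lemma circuit_map_shift:
  assumes "circuit_map m T"
  shows "\<exists>T'. circuit_map (Suc m) T' \<and> (\<forall>\<psi> s y. T' \<psi> (s # y) = T (\<lambda>z. \<psi> (s # z)) y)"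
  using assms
proof (induction rule: circuit_map.induct)
  case id
  then show ?case by (intro exI[of _ "\<lambda>\<psi>. \<psi>"]) (auto intro: circuit_map.id)
next
  case (gate T k a b u v)
  then obtain T' where T': "circuit_map (Suc m) T'" "\<And>\<psi> s y. T' \<psi> (s # y) = T (\<lambda>z. \<psi> (s # z)) y"
    by blast
  have "circuit_map (Suc m) (\<lambda>\<psi>. gate (Suc k) a b u v (T' \<psi>))"
    using T'(1) gate by (intro circuit_map.gate) auto
  moreover have "gate (Suc k) a b u v (T' \<psi>) (s # y) = gate k a b u v (T (\<lambda>z. \<psi> (s # z))) y"
    for \<psi> s y
    by (simp add: T'(2))
  ultimately show ?case by blast
qed

lemma qubit_prob_Suc:
  "qubit_prob (Suc m) \<psi> b = (\<Sum>y | length y = m. (cmod (\<psi> (b # False # y)))\<^sup>2)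
     + (\<Sum>y | length y = m. (cmod (\<psi> (b # True # y)))\<^sup>2)"
  unfolding qubit_prob_def by (rule sum_bit_strings_Suc)

text \<open>Rotating by different angles on the two parity sectors conjugates \<open>Z\<^sub>1\<close> into
  \<open>\<alpha> Z\<^sub>1 + \<beta> Z\<^sub>2\<close>, up to terms that flip the first qubit and thus have zero expectation.\<close>

lemma z_expectation_gate_0:
  fixes p q u v :: real
  assumes zero: "\<And>y. \<psi> ((\<not> s) # y) = 0" and \<phi>: "\<And>y. \<psi> (s # y) = \<phi> y"
    and total: "qubit_prob m \<phi> False + qubit_prob m \<phi> True = 1"
    and even: "p\<^sup>2 - q\<^sup>2 = \<alpha> + \<beta>" and odd: "u\<^sup>2 - v\<^sup>2 = \<alpha> - \<beta>"
  shows "z_expectation (Suc m) (gate 0 p q u v \<psi>) = \<alpha> * pm s + \<beta> * z_expectation m \<phi>"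
proof -
  let ?F = "qubit_prob m \<phi> False" and ?T = "qubit_prob m \<phi> True"
  have scale: "(\<Sum>y | length y = m. (cmod (of_real c * \<phi> (b # y)))\<^sup>2) = c\<^sup>2 * qubit_prob m \<phi> b" for c b
    by (simp add: qubit_prob_def sum_distrib_left norm_mult power_mult_distrib)
  \<comment> \<open>Given the first bit \<open>s\<close>, the parity determines the second, so the
    two sectors have weights \<open>?F\<close> and \<open>?T\<close>; \<alpha> gets multiplied by
    their sum and \<beta> by their difference.\<close>
  have "z_expectation (Suc m) (gate 0 p q u v \<psi>)
    = (if s then (q\<^sup>2 - p\<^sup>2) * ?T + (v\<^sup>2 - u\<^sup>2) * ?F else (p\<^sup>2 - q\<^sup>2) * ?F + (u\<^sup>2 - v\<^sup>2) * ?T)"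
  proof (cases s)
    case True
    then show ?thesis
      using zero \<phi> by (simp add: z_expectation_def qubit_prob_Suc scale algebra_simps)
  next
    case False
    have neg: "cmod (- (of_real c * z)) = cmod (of_real c * z)" for c z by simp
    show ?thesis
      using zero \<phi> False
      by (simp add: z_expectation_def qubit_prob_Suc scale neg algebra_simps del: norm_minus_cancel)
  qed
  also have "\<dots> = (if s then - (\<alpha> * (?F + ?T)) + \<beta> * (?F - ?T) else \<alpha> * (?F + ?T) + \<beta> * (?F - ?T))"
  proof -
    have swapped: "q\<^sup>2 - p\<^sup>2 = - \<alpha> - \<beta>" "v\<^sup>2 - u\<^sup>2 = \<beta> - \<alpha>"
      using even odd by linarith+
    show ?thesis unfolding even odd swapped by (simp add: algebra_simps)
  qed
  also have "\<dots> = \<alpha> * pm s + \<beta> * z_expectation m \<phi>"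
    unfolding total by (simp add: z_expectation_def)
  finally show ?thesis .
qed

lemma rotation_exists:
  fixes t :: real
  assumes "\<bar>t\<bar> \<le> 1"
  shows "\<exists>(p::real) (q::real). unit_pair p q \<and> (p\<^sup>2 - q\<^sup>2 :: real) = t"
proof -
  \<comment> \<open>For t = cos \<phi> with \<phi> in [0, pi] these are the cosine and sine of
    \<phi>/2.\<close>
  define p where "p = sqrt ((1 + t) / 2)"
  define q where "q = sqrt ((1 - t) / 2)"
  have sq: "p\<^sup>2 = (1 + t) / 2" "q\<^sup>2 = (1 - t) / 2"
    using assms by (simp_all add: p_def q_def)
  have "p\<^sup>2 - q\<^sup>2 = t" "p\<^sup>2 + q\<^sup>2 = 1"
    unfolding sq by (simp_all add: field_simps)
  moreover from this(2) have "unit_pair p q"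
    unfolding unit_pair_def complex_cnj_complex_of_real
    by (metis of_real_1 of_real_add of_real_mult power2_eq_square)
  ultimately show ?thesis by blast
qed

text \<open>The sign condition comes from the base case: a single qubit admits no gate, so its
  coefficient is +1. The last gate splits off \<open>l 0\<close>; the other coefficients, divided by
  their absolute sum, are again of the required form.\<close>

lemma circuit_with_coefficients:
  assumes "(\<Sum>k<Suc m. \<bar>l k\<bar>) = 1" "0 \<le> l m"
  shows "\<exists>T. circuit_map (Suc m) T \<and>
    (\<forall>x. length x = Suc m \<longrightarrow> z_expectation m (T (ket x)) = (\<Sum>k<Suc m. l k * pm (x ! k)))"
  using assms
proof (induction m arbitrary: l)
  case 0
  have "z_expectation 0 (ket x) = l 0 * pm (x ! 0)" if x: "length x = Suc 0" for x
  proof -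
    obtain s where "x = [s]" using x by (cases x) auto
    then show ?thesis
      using 0 by (cases s) (simp_all add: z_expectation_def qubit_prob_def ket_def)
  qed
  then show ?case by (auto intro!: exI[of _ "\<lambda>\<psi>. \<psi>"] circuit_map.id)
next
  case (Suc m)
  define \<alpha> where "\<alpha> = l 0"
  define \<beta> where "\<beta> = (\<Sum>k<Suc m. \<bar>l (Suc k)\<bar>)"
  have \<alpha>\<beta>: "\<bar>\<alpha>\<bar> + \<beta> = 1" "\<beta> \<ge> 0"
    using Suc.prems(1) unfolding \<alpha>_def \<beta>_def sum.lessThan_Suc_shift[of _ "Suc m"]
    by (auto intro: sum_nonneg)
  \<comment> \<open>A vanishing tail is replaced by coefficient 1 on the last qubit, which satisfies
    the induction hypothesis; the factor \<beta> = 0 removes it again.\<close>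
  define l' where "l' k = (if \<beta> = 0 then of_bool (k = m) else l (Suc k) / \<beta>)" for k
  have l': "\<beta> * l' k = l (Suc k)" if "k < Suc m" for k
  proof (cases "\<beta> = 0")
    case True
    then have "\<forall>k \<in> {..<Suc m}. \<bar>l (Suc k)\<bar> = 0"
      unfolding \<beta>_def by (subst (asm) sum_nonneg_eq_0_iff) auto
    then show ?thesis using True that by auto
  qed (simp add: l'_def)
  have sum1: "(\<Sum>k<Suc m. \<bar>l' k\<bar>) = 1"
  proof (cases "\<beta> = 0")
    case True
    then show ?thesis by (simp add: l'_def)
  next
    case False
    have "(\<Sum>k<Suc m. \<bar>l' k\<bar>) = (\<Sum>k<Suc m. \<bar>l (Suc k)\<bar> / \<beta>)"
      using False \<alpha>\<beta>(2) by (intro sum.cong) (auto simp: l'_def)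
    also have "\<dots> = 1"
      unfolding sum_divide_distrib[symmetric] using False by (simp add: \<beta>_def)
    finally show ?thesis .
  qed
  have "0 \<le> l' m" using Suc.prems(2) \<alpha>\<beta>(2) by (simp add: l'_def)
  with Suc.IH[OF sum1] obtain T where T: "circuit_map (Suc m) T" "\<And>x. length x = Suc m \<Longrightarrow>
      z_expectation m (T (ket x)) = (\<Sum>k<Suc m. l' k * pm (x ! k))"
    by blast
  obtain T' where T': "circuit_map (Suc (Suc m)) T'" "\<And>\<psi> s y. T' \<psi> (s # y) = T (\<lambda>z. \<psi> (s # z)) y"
    using circuit_map_shift[OF T(1)] by blast
  \<comment> \<open>The rotations in the even and odd sector must produce \<alpha> + \<beta> and
    \<alpha> - \<beta>, so both have to lie in [-1, 1].\<close>
  have "\<bar>\<alpha> + \<beta>\<bar> \<le> \<bar>\<alpha>\<bar> + \<bar>\<beta>\<bar>" "\<bar>\<alpha> - \<beta>\<bar> \<le> \<bar>\<alpha>\<bar> + \<bar>\<beta>\<bar>"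
    by (rule abs_triangle_ineq abs_triangle_ineq4)+
  then have bounds: "\<bar>\<alpha> + \<beta>\<bar> \<le> 1" "\<bar>\<alpha> - \<beta>\<bar> \<le> 1"
    using \<alpha>\<beta> by simp_all
  obtain p q :: real where pq: "unit_pair p q" "p\<^sup>2 - q\<^sup>2 = \<alpha> + \<beta>"
    using rotation_exists[OF bounds(1)] by blast
  obtain u v :: real where uv: "unit_pair u v" "u\<^sup>2 - v\<^sup>2 = \<alpha> - \<beta>"
    using rotation_exists[OF bounds(2)] by blast
  \<comment> \<open>The branch whose first bit differs from that of the input has zero amplitude and
    must keep it through the circuit on the other qubits.\<close>
  have null: "T (\<lambda>z. 0) y = 0" for y
    using T(1)
  proof (induction arbitrary: y rule: circuit_map.induct)
    case (gate T k a b u v)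
    then have "T (\<lambda>z. 0) = (\<lambda>z. 0)" by auto
    then show ?case using gate_linear[of k a b u v 0 "\<lambda>z. 0" 0 "\<lambda>z. 0" y] by simp
  qed simp
  have "circuit_map (Suc (Suc m)) (\<lambda>\<psi>. gate 0 p q u v (T' \<psi>))"
    using T'(1) pq(1) uv(1) by (intro circuit_map.gate) auto
  moreover have "z_expectation (Suc m) (gate 0 p q u v (T' (ket x)))
      = (\<Sum>k<Suc (Suc m). l k * pm (x ! k))" if x: "length x = Suc (Suc m)" for x
  proof -
    obtain s y where sy: "x = s # y" "length y = Suc m" using x by (cases x) auto
    have ket: "(\<lambda>z. ket x (s # z)) = ket y" "(\<lambda>z. ket x ((\<not> s) # z)) = (\<lambda>z. 0)"
      by (auto simp: ket_def sy)
    have "z_expectation (Suc m) (gate 0 p q u v (T' (ket x)))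
        = \<alpha> * pm s + \<beta> * z_expectation m (T (ket y))"
      using qubit_prob_circuit_total[OF T(1) sy(2)] pq(2) uv(2)
      by (intro z_expectation_gate_0) (simp_all only: T'(2) ket null)
    also have "\<beta> * z_expectation m (T (ket y)) = (\<Sum>k<Suc m. l (Suc k) * pm (y ! k))"
      unfolding T(2)[OF sy(2)] sum_distrib_left mult.assoc[symmetric]
      by (intro sum.cong) (auto simp: l' simp del: sum.lessThan_Suc)
    finally show ?thesis
      by (simp add: sum.lessThan_Suc_shift[of _ "Suc m"] sy \<alpha>_def del: sum.lessThan_Suc)
  qed
  ultimately show ?case by blast
qed

lemma circuit_of_integer_weight:
  assumes "linear_threshold_gate n f"
  shows "1 \<le> integer_weight n f"
    and "\<exists>U \<in> matchgate_circuits (n + 2).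
      computes_with_prob (n + 2) U n f (1 / 2 + 1 / (2 * real (integer_weight n f)))"
proof -
  let ?W = "real (integer_weight n f)"
  obtain w \<theta> where rep: "integer_representation n f w \<theta>" and W: "?W = (\<Sum>k<n. \<bar>w k\<bar>) + \<bar>\<theta>\<bar>"
    using linear_threshold_gate_integer_representation[OF assms] integer_weight_is_minimum(2)
    by blast
  define t where "t x = (\<Sum>k<n. w k * pm (x ! k)) + \<theta>" for x
  have sgn: "pm (f x) = sgn (t x)" if "length x = n" for x
    using rep that by (simp add: integer_representation_def ltg_representation_def t_def)
  have margin: "pm (f x) * t x \<ge> 1" if "length x = n" for x
  proof -
    have "t x \<in> \<int>"
      using rep unfolding t_def integer_representation_def pm_def
      by (intro Ints_add Ints_sum Ints_mult Ints_power) auto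
    moreover have "t x \<noteq> 0"
      using sgn[OF that] abs_pm[of "f x"] by (metis abs_0 sgn_0 zero_neq_one)
    ultimately have "1 \<le> \<bar>t x\<bar>" by (rule Ints_nonzero_abs_ge1)
    then show ?thesis unfolding sgn[OF that] by (simp add: abs_sgn mult.commute)
  qed
  \<comment> \<open>Any single input gives this bound. It also ensures that the success probability
    1/2 + 1/(2 W) is at most 1.\<close>
  have "1 \<le> ?W"
  proof -
    let ?x = "replicate n False"
    have "1 \<le> \<bar>t ?x\<bar>" using margin[of ?x] by (cases "f ?x") auto
    also have "\<dots> \<le> \<bar>\<Sum>k<n. w k * pm (?x ! k)\<bar> + \<bar>\<theta>\<bar>" unfolding t_def by linarith
    also have "\<dots> \<le> ?W"
      unfolding W using sum_abs[of "\<lambda>k. w k * pm (?x ! k)" "{..<n}"] by (simp add: abs_mult)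
    finally show ?thesis .
  qed
  then show "1 \<le> integer_weight n f" by simp
  \<comment> \<open>Position \<open>n\<close> is an ancilla in 0 and supplies the threshold.
    Position \<open>n + 1\<close> has weight 0, which meets the sign condition on the last
    coefficient whatever the sign of \<theta>.\<close>
  define l where "l k = (if k < n then w k / ?W else if k = n then \<theta> / ?W else 0)" for k
  have sum_l: "(\<Sum>k<Suc (Suc n). g k (l k)) = (\<Sum>k<n. g k (w k / ?W)) + g n (\<theta> / ?W) + g (Suc n) 0"
    for g :: "nat \<Rightarrow> real \<Rightarrow> real"
    by (simp add: l_def)
  have "(\<Sum>k<Suc (Suc n). \<bar>l k\<bar>) = (\<Sum>k<n. \<bar>w k / ?W\<bar>) + \<bar>\<theta> / ?W\<bar>"
    by (simp add: sum_l[of "\<lambda>k r. \<bar>r\<bar>"] del: sum.lessThan_Suc)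
  also have "\<dots> = ((\<Sum>k<n. \<bar>w k\<bar>) + \<bar>\<theta>\<bar>) / ?W"
    by (simp add: sum_divide_distrib add_divide_distrib)
  also have "\<dots> = 1"
    unfolding W[symmetric] using \<open>1 \<le> ?W\<close> by simp
  finally have "(\<Sum>k<Suc (Suc n). \<bar>l k\<bar>) = 1" .
  then obtain T where T: "circuit_map (Suc (Suc n)) T" "\<And>x. length x = Suc (Suc n) \<Longrightarrow>
      z_expectation (Suc n) (T (ket x)) = (\<Sum>k<Suc (Suc n). l k * pm (x ! k))"
    using circuit_with_coefficients[where m = "Suc n" and l = l] by (auto simp: l_def)
  obtain U where U: "U \<in> matchgate_circuits (Suc (Suc n))" "implements (Suc (Suc n)) U T"
    using map_implemented_by_circuit[OF T(1)] by blast
  have "first_qubit_prob (Suc (Suc n)) (U *\<^sub>v basis_state (x @ [False, False])) (f x)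
      \<ge> 1 / 2 + 1 / (2 * ?W)" if x: "length x = n" for x
  proof -
    let ?y = "x @ [False, False]"
    have "z_expectation (Suc n) (T (ket ?y)) = (\<Sum>k<Suc (Suc n). l k * pm (?y ! k))"
      using x by (intro T(2)) simp
    also have "\<dots> = (\<Sum>k<n. w k / ?W * pm (?y ! k)) + \<theta> / ?W * pm (?y ! n) + 0 * pm (?y ! Suc n)"
      by (rule sum_l)
    also have "\<dots> = (\<Sum>k<n. w k / ?W * pm (?y ! k)) + \<theta> / ?W"
      using x by (simp add: nth_append)
    also have "(\<Sum>k<n. w k / ?W * pm (?y ! k)) = (\<Sum>k<n. w k * pm (x ! k)) / ?W"
      unfolding sum_divide_distrib using x by (intro sum.cong) (auto simp: nth_append)
    finally have "z_expectation (Suc n) (T (ket ?y)) = t x / ?W"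
      by (simp add: t_def add_divide_distrib)
    moreover have "1 / ?W \<le> pm (f x) * t x / ?W"
      using margin[OF x] by (intro divide_right_mono) auto
    ultimately show ?thesis
      using first_qubit_prob_eq[OF T(1) U(2), of ?y "f x"] x
      by (simp add: field_simps)
  qed
  then have "computes_with_prob (n + 2) U n f (1 / 2 + 1 / (2 * ?W))"
    by (simp add: computes_with_prob_def numeral_2_eq_2)
  then show "\<exists>U \<in> matchgate_circuits (n + 2).
      computes_with_prob (n + 2) U n f (1 / 2 + 1 / (2 * ?W))"
    using U(1) by auto
qed

theorem theorem3:
  fixes F :: "nat \<Rightarrow> bool list \<Rightarrow> bool"
  shows "matchgate_computable_poly_bounded_error F \<longleftrightarrow>
           (\<forall>n\<ge>1. linear_threshold_gate n (F n)) \<and> polynomial_integer_weight F"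
proof (intro iffI conjI)
  assume "matchgate_computable_poly_bounded_error F"
  then obtain p :: "nat \<Rightarrow> real" and q :: "real poly" and m U where
    p: "\<And>n. n \<ge> 1 \<Longrightarrow> 1 / 2 < p n" and
    q: "\<And>n::nat. n \<ge> 1 \<Longrightarrow> poly q (real n) > 0" and
    pq: "\<forall>\<^sub>F n in sequentially. p n \<ge> 1 / 2 + 1 / poly q (real n)" and
    U: "\<And>n. n \<ge> 1 \<Longrightarrow> n \<le> m n" "\<And>n. n \<ge> 1 \<Longrightarrow> U n \<in> matchgate_circuits (m n)"
      "\<And>n. n \<ge> 1 \<Longrightarrow> computes_with_prob (m n) (U n) n (F n) (p n)"
    unfolding matchgate_computable_poly_bounded_error_def by blast
  note weight = integer_weight_of_circuit[OF U(2) _ U(1) U(3) p]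
  show "\<forall>n\<ge>1. linear_threshold_gate n (F n)"
    using weight(1) by blast
  obtain N where N: "\<And>n. n \<ge> N \<Longrightarrow> p n \<ge> 1 / 2 + 1 / poly q (real n)"
    using pq by (auto simp: eventually_sequentially)
  \<comment> \<open>The bound on \<open>p\<close> holds only from \<open>N\<close> on; this constant
    covers the finitely many earlier weights.\<close>
  define K where "K = (\<Sum>n<N. real (integer_weight n (F n)))"
  have "real (integer_weight n (F n)) \<le> K + (real n + 1) * (poly q (real n) / 2 + 1)"
    if n: "n \<ge> 1" for n
  proof (cases "n < N")
    case True
    then have "real (integer_weight n (F n)) \<le> K"
      unfolding K_def by (intro member_le_sum) auto
    then show ?thesis using q[OF n] by (simp add: add_increasing2)
  next
    case False
    have "1 / (2 * p n - 1) \<le> poly q (real n) / 2"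
      using N[of n] False q[OF n] p[OF n] by (simp add: field_simps)
    then have "(real n + 1) * (1 / (2 * p n - 1) + 1) \<le> (real n + 1) * (poly q (real n) / 2 + 1)"
      by (intro mult_left_mono) auto
    moreover have "K \<ge> 0" by (simp add: K_def sum_nonneg)
    moreover have "real (integer_weight n (F n)) \<le> (real n + 1) * (1 / (2 * p n - 1) + 1)"
      by (rule weight(2)) (use n in auto)
    ultimately show ?thesis by linarith
  qed
  moreover have "poly ([:K:] + [:1, 1:] * (smult (1 / 2) q + 1)) (real n)
      = K + (real n + 1) * (poly q (real n) / 2 + 1)" for n
    by (simp add: algebra_simps)
  ultimately show "polynomial_integer_weight F"
    unfolding polynomial_integer_weight_def by metis
next
  assume "(\<forall>n\<ge>1. linear_threshold_gate n (F n)) \<and> polynomial_integer_weight F"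
  then obtain q :: "real poly" where ltg: "\<And>n. n \<ge> 1 \<Longrightarrow> linear_threshold_gate n (F n)"
    and q: "\<And>n. n \<ge> 1 \<Longrightarrow> real (integer_weight n (F n)) \<le> poly q (real n)"
    unfolding polynomial_integer_weight_def by blast
  define p where "p n = 1 / 2 + 1 / (2 * real (integer_weight n (F n)))" for n
  have "\<forall>n. \<exists>U. n \<ge> 1 \<longrightarrow> U \<in> matchgate_circuits (n + 2) \<and> computes_with_prob (n + 2) U n (F n) (p n)"
    using circuit_of_integer_weight(2)[OF ltg] unfolding p_def by blast
  then obtain U where U: "\<And>n. n \<ge> 1 \<Longrightarrow>
      U n \<in> matchgate_circuits (n + 2) \<and> computes_with_prob (n + 2) (U n) n (F n) (p n)"
    by metis
  have W: "1 \<le> real (integer_weight n (F n))" if "n \<ge> 1" for n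
    using circuit_of_integer_weight(1)[OF ltg[OF that]] by simp
  have p: "1 / 2 < p n" "p n \<le> 1" if "n \<ge> 1" for n
    using W[OF that] by (simp_all add: p_def field_simps)
  \<comment> \<open>Twice \<open>q\<close>, because the excess over 1/2 is 1/(2 W) with W at most
    \<open>q\<close>.\<close>
  have q_pos: "poly (smult 2 q) (real n) > 0" if "n \<ge> 1" for n
    using W[OF that] q[OF that] by simp
  have pq: "p n \<ge> 1 / 2 + 1 / poly (smult 2 q) (real n)" if "n \<ge> 1" for n
    using W[OF that] q[OF that] by (simp add: p_def frac_le)
  have "\<forall>\<^sub>F n in sequentially. p n \<ge> 1 / 2 + 1 / poly (smult 2 q) (real n)"
    using eventually_ge_at_top[of 1] by (rule eventually_mono) (rule pq)
  then show "matchgate_computable_poly_bounded_error F"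
    unfolding matchgate_computable_poly_bounded_error_def
    using p q_pos U
    by (intro exI[of _ p] exI[of _ "smult 2 q"] exI[of _ "\<lambda>n. n + 2"] exI[of _ U]) auto
qed

end
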